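(* The following is a complete list of the (nonzero, proper) semisimple real Lie subalgebras of $\mathfrak{su}(2,1)$ up to conjugation in $\mathrm{SU}(2,1)$: (1) $\mathfrak{v}_{3,4}=\langle A_4,\;A_6,\;A_7\rangle$; (2) $\mathfrak{v}_{3,5}=\langle A_1+A_2,\;A_5,\;A_6\rangle$; (3) $\mathfrak{v}_{3,6}=\langle A_1,\;A_3,\;A_4\rangle$. That is, every nonzero proper semisimple real subalgebra of $\mathfrak{su}(2,1)$ is conjugate under $\mathrm{SU}(2,1)$ to one of these three, and these three are pairwise non-conjugate under $\mathrm{SU}(2,1)$.
   Context: Let $N=\mathrm{diag}(1,1,-1)$. $\mathfrak{su}(2,1)$ is the real Lie algebra of traceless complex $3\times3$ matrices $x$ with $-N\bar x^{t}N^{-1}=x$, and $\mathrm{SU}(2,1)$ is the group of $g\in\mathrm{SL}_3(\mathbb{C})$ with $N(\bar g^{t})^{-1}N^{-1}=g$. $\mathrm{SU}(2,1)$ acts on subalgebras by $g\cdot\mathfrak{v}=g\mathfrak{v}g^{-1}$; conjugate means lying in the same orbit. With $E_{ij}$ the matrix units, the real basis of $\mathfrak{su}(2,1)$ used is $A_1=i(E_{11}-E_{22})$, $A_2=i(E_{22}-E_{33})$, $A_3=E_{12}-E_{21}$, $A_4=i(E_{12}+E_{21})$, $A_5=E_{13}+E_{31}$, $A_6=i(E_{13}-E_{31})$, $A_7=E_{23}+E_{32}$, $A_8=i(E_{23}-E_{32})$. $\langle\cdots\rangle$ denotes the real linear span. *)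

theory Defs
  imports "HOL-Analysis.Analysis"
begin

text \<open>
  Real Lie algebras of complex matrices, with the commutator as bracket. Throughout,
  \<^term>\<open>subspace\<close> and \<^term>\<open>span\<close> refer to the real vector space structure of the matrix type
  (scalar multiplication by real numbers), not to the complex one.
\<close>

definition bracket :: "complex^'n^'n \<Rightarrow> complex^'n^'n \<Rightarrow> complex^'n^'n" where
  "bracket x y = x ** y - y ** x"

definition lie_subalgebra :: "(complex^'n^'n) set \<Rightarrow> (complex^'n^'n) set \<Rightarrow> bool" where
  "lie_subalgebra v L \<longleftrightarrow> v \<subseteq> L \<and> subspace v \<and> (\<forall>x\<in>v. \<forall>y\<in>v. bracket x y \<in> v)"

definition lie_ideal :: "(complex^'n^'n) set \<Rightarrow> (complex^'n^'n) set \<Rightarrow> bool" where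
  "lie_ideal I v \<longleftrightarrow> I \<subseteq> v \<and> subspace I \<and> (\<forall>x\<in>v. \<forall>y\<in>I. bracket x y \<in> I)"

definition derived :: "(complex^'n^'n) set \<Rightarrow> (complex^'n^'n) set" where
  "derived v = span {bracket x y | x y. x \<in> v \<and> y \<in> v}"

definition lie_solvable :: "(complex^'n^'n) set \<Rightarrow> bool" where
  "lie_solvable v \<longleftrightarrow> (\<exists>n. (derived ^^ n) v = {0})"

text \<open>
  Semisimple means that the radical (the largest solvable ideal) vanishes. With this convention
  the zero algebra counts as semisimple.
\<close>

definition lie_semisimple :: "(complex^'n^'n) set \<Rightarrow> bool" where
  "lie_semisimple v \<longleftrightarrow> (\<forall>I. lie_ideal I v \<and> lie_solvable I \<longrightarrow> I = {0})"

definition conj_transpose :: "complex^'n^'n \<Rightarrow> complex^'n^'n" where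
  "conj_transpose x = transpose (map_matrix cnj x)"

definition matrix_unit :: "3 \<Rightarrow> 3 \<Rightarrow> complex^3^3" where
  "matrix_unit i j = (\<chi> a b. if a = i \<and> b = j then 1 else 0)"

definition itimes :: "complex^3^3 \<Rightarrow> complex^3^3" where
  "itimes x = map_matrix (\<lambda>z. \<i> * z) x"

definition N21 :: "complex^3^3" where
  "N21 = matrix_unit 1 1 + matrix_unit 2 2 - matrix_unit 3 3"

definition su21 :: "(complex^3^3) set" where
  "su21 = {x. trace x = 0 \<and> - (N21 ** conj_transpose x ** matrix_inv N21) = x}"

definition SU21 :: "(complex^3^3) set" where
  "SU21 = {g. det g = 1 \<and> N21 ** matrix_inv (conj_transpose g) ** matrix_inv N21 = g}"

definition SU21_conjugate :: "(complex^3^3) set \<Rightarrow> (complex^3^3) set \<Rightarrow> bool" where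
  "SU21_conjugate v w \<longleftrightarrow> (\<exists>g\<in>SU21. w = (\<lambda>x. g ** x ** matrix_inv g) ` v)"

definition A1 :: "complex^3^3" where "A1 = itimes (matrix_unit 1 1 - matrix_unit 2 2)"
definition A2 :: "complex^3^3" where "A2 = itimes (matrix_unit 2 2 - matrix_unit 3 3)"
definition A3 :: "complex^3^3" where "A3 = matrix_unit 1 2 - matrix_unit 2 1"
definition A4 :: "complex^3^3" where "A4 = itimes (matrix_unit 1 2 + matrix_unit 2 1)"
definition A5 :: "complex^3^3" where "A5 = matrix_unit 1 3 + matrix_unit 3 1"
definition A6 :: "complex^3^3" where "A6 = itimes (matrix_unit 1 3 - matrix_unit 3 1)"
definition A7 :: "complex^3^3" where "A7 = matrix_unit 2 3 + matrix_unit 3 2"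

definition v34 :: "(complex^3^3) set" where "v34 = span {A4, A6, A7}"
definition v35 :: "(complex^3^3) set" where "v35 = span {A1 + A2, A5, A6}"
definition v36 :: "(complex^3^3) set" where "v36 = span {A1, A3, A4}"

definition semisimple_proper_subalgebra :: "(complex^3^3) set \<Rightarrow> bool" where
  "semisimple_proper_subalgebra v \<longleftrightarrow>
     lie_subalgebra v su21 \<and> v \<noteq> {0} \<and> v \<noteq> su21 \<and> lie_semisimple v"

end

theory Submission
  imports Defs
begin

text \<open>
  The trace form \<open>tr (x y)\<close> is real on \<open>su(2,1)\<close>, and the classification splits according to its sign
  on a semisimple subalgebra \<open>v\<close>.

  If \<open>tr (x\<^sup>2) > 0\<close> for some \<open>x\<close> in \<open>v\<close>, then \<open>x\<close> has eigenvalues \<open>k\<close> and \<open>- cnj k\<close> off the imaginary axis.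
  Their eigenvectors are isotropic, and in a basis adapted to them \<open>x\<close> is diagonal. The adjoint action of
  \<open>x\<close> grades \<open>v\<close>. If the two short root spaces of \<open>v\<close> vanish, \<open>v\<close> lies in \<open>u(1,1)\<close> and equals its
  semisimple part. If just one of them vanishes, \<open>v\<close> is triangular, hence solvable. If one of them is
  two-dimensional and the other is not zero, \<open>v\<close> is everything. Otherwise both are real lines, which a
  diagonal unitary matrix makes the standard ones, and \<open>v\<close> is the irreducible \<open>so(2,1)\<close>.

  If the trace form is negative semidefinite on \<open>v\<close>, choose a singular \<open>z \<noteq> 0\<close> in \<open>v\<close>. It has no
  isotropic eigenvector, since otherwise \<open>v\<close> would be triangular in an adapted basis. So \<open>z\<close> is not
  nilpotent, its eigenvalues are \<open>0\<close> and \<open>\<plusminus>\<i>\<close> up to scaling, and it is diagonal in an orthonormal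
  basis. Semidefiniteness then removes the noncompact root spaces, \<open>v\<close> lies in \<open>u(2)\<close>, and \<open>v\<close> is
  \<open>su(2)\<close>.
\<close>

section \<open>Lie algebras of matrices\<close>

text \<open>Semisimplicity enters only through the absence of nonzero solvable ideals; a degenerate
  configuration is refuted by an explicit chain of subspaces that contains its brackets, without
  Levi decomposition or Cartan's criterion. The trace form stands in for the Killing form: it is
  read off from the matrix entries and is invariant under conjugation, so its sign also separates
  \<open>v36\<close> from the other two algebras. The obstacle that shapes the computations is that
  the subalgebras are real while the roots are complex. A root component can be split off only by a
  polynomial in the adjoint map with real coefficients, and a complex factor can be cancelled only
  through its conjugate. Conjugating elements are not built case by case. Two subalgebras that have
  the same matrices in two bases with equal Gram matrix are conjugate by a unitary change of basis,
  whose determinant is then corrected by a scalar.\<close>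

lemma matrix_scaleR_left: "(k *\<^sub>R A) ** B = k *\<^sub>R (A ** B)"
  for A :: "complex^'n^'m" and B :: "complex^'p^'n"
  by (vector matrix_matrix_mult_def scaleR_right.sum)

lemma matrix_scaleR_right: "A ** (k *\<^sub>R B) = k *\<^sub>R (A ** B)"
  for A :: "complex^'n^'m" and B :: "complex^'p^'n"
  by (vector matrix_matrix_mult_def scaleR_right.sum)

lemma matrix_diff_left: "(A - B) ** C = A ** C - B ** C"
  for A :: "complex^'n^'m" and C :: "complex^'p^'n"
  by (vector matrix_matrix_mult_def sum_subtractf left_diff_distrib)

lemma matrix_diff_right: "A ** (B - C) = A ** B - A ** C"
  for A :: "complex^'n^'m" and C :: "complex^'p^'n"
  by (vector matrix_matrix_mult_def sum_subtractf right_diff_distrib)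

lemma matrix_add_left: "(A + B) ** C = A ** C + B ** C"
  for A :: "complex^'n^'m" and C :: "complex^'p^'n"
  by (vector matrix_matrix_mult_def sum.distrib distrib_right)

lemmas matrix_linear_simps =
  matrix_scaleR_left matrix_scaleR_right matrix_diff_left matrix_diff_right
  matrix_add_left matrix_add_ldistrib

lemma bracket_add_left: "bracket (x + y) z = bracket x z + bracket y z"
  and bracket_add_right: "bracket z (x + y) = bracket z x + bracket z y"
  and bracket_diff_left: "bracket (x - y) z = bracket x z - bracket y z"
  and bracket_diff_right: "bracket z (x - y) = bracket z x - bracket z y"
  and bracket_scaleR_left: "bracket (k *\<^sub>R x) z = k *\<^sub>R bracket x z"
  and bracket_scaleR_right: "bracket z (k *\<^sub>R x) = k *\<^sub>R bracket z x"
  by (simp_all add: bracket_def matrix_linear_simps algebra_simps)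

lemma subspace_scaleR_cancel:
  assumes "subspace S" "k *\<^sub>R x \<in> S" "k \<noteq> 0"
  shows "x \<in> S"
  using subspace_scale[OF assms(1,2), of "1 / k"] assms(3) by simp

lemma subspace_scaleR_iff:
  assumes "subspace S" "k \<noteq> 0"
  shows "k *\<^sub>R x \<in> S \<longleftrightarrow> x \<in> S"
  using subspace_scaleR_cancel[OF assms(1) _ assms(2)] subspace_scale[OF assms(1)] by metis

lemma bracket_self: "bracket x x = 0"
  by (simp add: bracket_def)

lemma bracket_commute: "bracket y x = - bracket x y"
  by (simp add: bracket_def)

lemma bracket_zero_left: "bracket 0 x = 0" and bracket_zero_right: "bracket x 0 = 0"
  using bracket_scaleR_left[of 0 x x] bracket_scaleR_right[of x 0 x] by simp_all

lemmas bracket_simps = bracket_diff_left bracket_diff_right bracket_add_left bracket_add_right bracket_scaleR_left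
  bracket_scaleR_right bracket_self bracket_zero_left bracket_zero_right

section \<open>The derived series and solvability\<close>

lemma derived_subset:
  assumes "subspace S" "\<And>x y. x \<in> v \<Longrightarrow> y \<in> v \<Longrightarrow> bracket x y \<in> S"
  shows "derived v \<subseteq> S"
  unfolding derived_def by (rule span_minimal) (use assms in auto)

lemma bracket_in_derived: "x \<in> v \<Longrightarrow> y \<in> v \<Longrightarrow> bracket x y \<in> derived v"
  unfolding derived_def by (rule span_base) auto

lemma subspace_derived: "subspace (derived v)"
  unfolding derived_def by (rule subspace_span)

lemma derived_mono: "v \<subseteq> w \<Longrightarrow> derived v \<subseteq> derived w"
  unfolding derived_def by (rule span_mono) auto

lemma derived_funpow_mono: "v \<subseteq> w \<Longrightarrow> (derived ^^ n) v \<subseteq> (derived ^^ n) w"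
  by (induction n) (simp_all add: derived_mono)

lemma zero_in_derived_funpow: "0 \<in> v \<Longrightarrow> 0 \<in> (derived ^^ n) v"
  by (cases n) (auto simp: derived_def span_zero)

lemma lie_solvableI: "(derived ^^ n) v = {0} \<Longrightarrow> lie_solvable v"
  unfolding lie_solvable_def by (rule exI)

lemma lie_solvableE:
  assumes "lie_solvable v"
  obtains n where "(derived ^^ n) v = {0}"
  using assms unfolding lie_solvable_def by (rule exE)

lemma lie_solvable_subset:
  assumes "v \<subseteq> w" "0 \<in> v" "lie_solvable w"
  shows "lie_solvable v"
proof -
  obtain n where "(derived ^^ n) w = {0}" using assms(3) by (rule lie_solvableE)
  then have "(derived ^^ n) v = {0}"
    using derived_funpow_mono[OF assms(1), of n] zero_in_derived_funpow[OF assms(2), of n] by auto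
  then show ?thesis by (rule lie_solvableI)
qed

lemma lie_solvable_zero: "lie_solvable {0}"
  by (rule lie_solvableI[of 0]) simp

text \<open>Solvability can thus be shown along a chain of explicit subspaces that merely contain
  the brackets, without computing the derived series.\<close>

lemma lie_solvable_step:
  assumes "lie_solvable S" "subspace S" "\<And>x y. x \<in> v \<Longrightarrow> y \<in> v \<Longrightarrow> bracket x y \<in> S"
  shows "lie_solvable v"
proof -
  have "lie_solvable (derived v)"
  proof (rule lie_solvable_subset)
    show "derived v \<subseteq> S" using assms(2,3) by (rule derived_subset)
    show "0 \<in> derived v" unfolding derived_def by (rule span_zero)
  qed (rule assms(1))
  then obtain n where "(derived ^^ n) (derived v) = {0}" by (rule lie_solvableE)
  then have "(derived ^^ Suc n) v = {0}" by (simp only: funpow_Suc_right o_apply)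
  then show ?thesis by (rule lie_solvableI)
qed

lemma lie_solvable_abelian:
  assumes "\<And>x y. x \<in> v \<Longrightarrow> y \<in> v \<Longrightarrow> bracket x y = 0"
  shows "lie_solvable v"
proof (rule lie_solvable_step)
  show "lie_solvable {0}" by (rule lie_solvable_zero)
  show "subspace {0}" by (rule subspace_single_0)
  show "bracket x y \<in> {0}" if "x \<in> v" "y \<in> v" for x y
    using assms[OF that] by simp
qed

lemma bracket_span_singleton:
  assumes "x \<in> span {p}" "y \<in> span {p}"
  shows "bracket x y = 0"
  using assms by (auto simp: span_singleton bracket_simps)

lemma span_pairE:
  assumes "x \<in> span {p, q}"
  obtains a b where "x = a *\<^sub>R p + b *\<^sub>R q"
proof -
  obtain a where "x - a *\<^sub>R p \<in> span {q}" using assms by (auto simp: span_insert)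
  then obtain b where "x - a *\<^sub>R p = b *\<^sub>R q" unfolding span_singleton by blast
  then have "x = a *\<^sub>R p + b *\<^sub>R q" by (metis diff_add_cancel add.commute)
  then show ?thesis by (rule that)
qed

lemma span_tripleE:
  assumes "x \<in> span {p, q, r}"
  obtains a b c where "x = a *\<^sub>R p + b *\<^sub>R q + c *\<^sub>R r"
proof -
  obtain a where "x - a *\<^sub>R p \<in> span {q, r}" using assms unfolding span_insert[of p] by blast
  then obtain b c where "x - a *\<^sub>R p = b *\<^sub>R q + c *\<^sub>R r" by (rule span_pairE)
  then have "x = a *\<^sub>R p + b *\<^sub>R q + c *\<^sub>R r" by (metis diff_add_cancel add.commute add.assoc)
  then show ?thesis by (rule that)
qed

lemma bracket_span_pair:
  assumes "x \<in> span {p, q}" "y \<in> span {p, q}"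
  shows "bracket x y \<in> span {bracket p q}"
proof -
  obtain a b c d where "x = a *\<^sub>R p + b *\<^sub>R q" "y = c *\<^sub>R p + d *\<^sub>R q"
    using assms span_pairE by metis
  then have "bracket x y = (a * d - b * c) *\<^sub>R bracket p q"
    using bracket_commute[of q p] by (simp add: bracket_simps algebra_simps)
  then show ?thesis by (simp add: span_base span_scale)
qed

text \<open>All brackets of elements of the plane lie on the line through
  \<open>bracket p q\<close>, and a line is abelian. The plane itself need not be closed under the
  bracket.\<close>

lemma lie_solvable_span_pair: "lie_solvable (span {p, q})"
proof (rule lie_solvable_step)
  show "lie_solvable (span {bracket p q})"
    by (rule lie_solvable_abelian) (rule bracket_span_singleton)
qed (rule subspace_span, rule bracket_span_pair)

lemma lie_solvable_dim_le_2:
  assumes "subspace v" "dim v \<le> 2"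
  shows "lie_solvable v"
proof -
  obtain B where B: "B \<subseteq> v" "independent B" "v \<subseteq> span B" "card B = dim v"
    using basis_exists[of v] by metis
  have "finite B" using B(2) by (rule independent_imp_finite)
  have "v = span B" using B assms(1) by (metis span_subspace)
  have "\<exists>p q. B \<subseteq> {p, q}"
  proof -
    have "card B = 0 \<or> card B = 1 \<or> card B = 2" using B(4) assms(2) by linarith
    then show ?thesis using \<open>finite B\<close>
      by (auto simp: card_1_singleton_iff card_2_iff)
  qed
  then obtain p q where "B \<subseteq> {p, q}" by blast
  then have "v \<subseteq> span {p, q}" using \<open>v = span B\<close> span_mono by metis
  then show ?thesis
    using lie_solvable_subset lie_solvable_span_pair assms(1) subspace_0 by metis
qed

lemma lie_semisimpleD:
  assumes "lie_semisimple w" "lie_ideal I w" "lie_solvable I"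
  shows "I = {0}"
  using assms(1)[unfolded lie_semisimple_def, rule_format, OF conjI[OF assms(2,3)]] .

lemma lie_semisimple_not_solvable:
  assumes "lie_semisimple w" "subspace w" "\<And>x y. x \<in> w \<Longrightarrow> y \<in> w \<Longrightarrow> bracket x y \<in> w"
    and "lie_solvable w"
  shows "w = {0}"
proof (rule lie_semisimpleD[OF assms(1) _ assms(4)])
  show "lie_ideal w w" unfolding lie_ideal_def using assms(2,3) by simp
qed

text \<open>
  The intersection of \<^term>\<open>w\<close> with the three-dimensional algebra is an ideal; if it
  were smaller, it would be solvable, hence zero, and \<^term>\<open>w\<close> would be abelian.
\<close>

lemma semisimple_in_central_extension:
  assumes ss: "lie_semisimple w" and sub: "subspace w" and ne: "w \<noteq> {0}"
    and cl: "\<And>x y. x \<in> w \<Longrightarrow> y \<in> w \<Longrightarrow> bracket x y \<in> w"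
    and br: "\<And>x y. x \<in> w \<Longrightarrow> y \<in> w \<Longrightarrow> bracket x y \<in> span {a, b, c}"
    and dec: "\<And>x. x \<in> w \<Longrightarrow> \<exists>k. x - k *\<^sub>R Z \<in> span {a, b, c}"
    and cen: "\<And>x. x \<in> w \<Longrightarrow> bracket x Z = 0"
  shows "w = span {a, b, c}"
proof -
  define I where "I = w \<inter> span {a, b, c}"
  have Isub: "subspace I" unfolding I_def by (simp add: sub subspace_inter)
  have Iid: "lie_ideal I w"
    unfolding lie_ideal_def using Isub cl br by (auto simp: I_def)
  have "\<not> dim I \<le> 2"
  proof
    assume "dim I \<le> 2"
    then have "I = {0}"
      by (rule lie_semisimpleD[OF ss Iid lie_solvable_dim_le_2[OF Isub]])
    then have "\<And>x y. x \<in> w \<Longrightarrow> y \<in> w \<Longrightarrow> bracket x y = 0" using cl br I_def by blast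
    then show False
      using lie_semisimple_not_solvable[OF ss sub cl lie_solvable_abelian] ne by simp
  qed
  moreover have "dim (span {a, b, c}) \<le> 3"
  proof -
    have "dim (span {a, b, c}) \<le> card {a, b, c}" by (simp add: dim_le_card')
    also have "\<dots> \<le> 3" by (simp add: card_insert_if)
    finally show ?thesis .
  qed
  ultimately have "I = span {a, b, c}"
    by (intro subspace_dim_equal) (auto simp: I_def sub intro: subspace_inter)
  then have le: "span {a, b, c} \<subseteq> w" by (auto simp: I_def)
  show ?thesis
  proof (rule subset_antisym[OF _ le], rule subsetI)
    fix x assume x: "x \<in> w"
    obtain k where k: "x - k *\<^sub>R Z \<in> span {a, b, c}" using dec[OF x] by blast
    show "x \<in> span {a, b, c}"
    proof (cases "k *\<^sub>R Z = 0")
      case True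
      show ?thesis using k[unfolded True diff_zero] .
    next
      case False
      \<comment> \<open>A nonzero multiple of \<open>Z\<close> would be a difference of two elements
        of \<open>w\<close>; the line through \<open>Z\<close> would then be an abelian
        ideal.\<close>
      have "x - (x - k *\<^sub>R Z) \<in> w" by (rule subspace_diff[OF sub x subsetD[OF le k]])
      then have "Z \<in> w" using False subspace_scaleR_cancel[OF sub, of k Z] by simp
      have "lie_ideal (span {Z}) w"
        unfolding lie_ideal_def
      proof (intro conjI ballI)
        show "span {Z} \<subseteq> w" using \<open>Z \<in> w\<close> sub by (simp add: span_minimal)
        fix x y assume "x \<in> w" "y \<in> span {Z}"
        then show "bracket x y \<in> span {Z}"
          using cen by (auto simp: span_singleton bracket_simps)
      qed simp
      moreover have "lie_solvable (span {Z})"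
        by (rule lie_solvable_abelian) (rule bracket_span_singleton)
      ultimately have "span {Z} = {0}" by (rule lie_semisimpleD[OF ss])
      then have "Z = 0" using span_base[of Z "{Z}"] by simp
      then show ?thesis using False by simp
    qed
  qed
qed

section \<open>Transport along isomorphisms, and algebras with cyclic brackets\<close>

lemma derived_image:
  assumes "linear f" "\<And>x y. f (bracket x y) = bracket (f x) (f y)"
  shows "derived (f ` v) = f ` derived v"
proof -
  have "{bracket x y |x y. x \<in> f ` v \<and> y \<in> f ` v}
      = (\<lambda>(x, y). bracket (f x) (f y)) ` (v \<times> v)" by auto
  also have "\<dots> = (\<lambda>(x, y). f (bracket x y)) ` (v \<times> v)" by (simp only: assms(2))
  also have "\<dots> = f ` {bracket x y |x y. x \<in> v \<and> y \<in> v}" by auto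
  finally have "{bracket x y |x y. x \<in> f ` v \<and> y \<in> f ` v} =
    f ` {bracket x y |x y. x \<in> v \<and> y \<in> v}" .
  then show ?thesis unfolding derived_def by (simp add: linear_span_image[OF assms(1)])
qed

lemma lie_solvable_image:
  assumes "linear f" "\<And>x y. f (bracket x y) = bracket (f x) (f y)" "lie_solvable v"
  shows "lie_solvable (f ` v)"
proof -
  have "(derived ^^ n) (f ` v) = f ` (derived ^^ n) v" for n
    by (induction n) (simp_all add: derived_image[OF assms(1,2)])
  moreover obtain n where "(derived ^^ n) v = {0}" using assms(3) by (rule lie_solvableE)
  ultimately have "(derived ^^ n) (f ` v) = {0}" using linear_0[OF assms(1)] by simp
  then show ?thesis by (rule lie_solvableI)
qed

lemma lie_semisimple_image:
  assumes f: "linear f" "\<And>x y. f (bracket x y) = bracket (f x) (f y)"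
    and g: "linear g" "\<And>x y. g (bracket x y) = bracket (g x) (g y)"
    and gf: "\<And>x. g (f x) = x" and fg: "\<And>x. f (g x) = x"
    and ss: "lie_semisimple v"
  shows "lie_semisimple (f ` v)"
  unfolding lie_semisimple_def
proof (intro allI impI, elim conjE)
  fix I assume I: "lie_ideal I (f ` v)" "lie_solvable I"
  have "lie_ideal (g ` I) v"
    unfolding lie_ideal_def
  proof (intro conjI ballI)
    have "I \<subseteq> f ` v" using I(1) unfolding lie_ideal_def by blast
    then show "g ` I \<subseteq> v" using gf by auto
    show "subspace (g ` I)" using I(1) g(1) linear_subspace_image unfolding lie_ideal_def by blast
    fix x y assume "x \<in> v" "y \<in> g ` I"
    then have "f x \<in> f ` v" "f y \<in> I" using fg by auto
    then have "bracket (f x) (f y) \<in> I" using I(1) unfolding lie_ideal_def by blast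
    then have "g (bracket (f x) (f y)) \<in> g ` I" by blast
    then show "bracket x y \<in> g ` I" by (simp only: f(2)[symmetric] gf)
  qed
  moreover have "lie_solvable (g ` I)" by (rule lie_solvable_image[where f = g]) fact+
  ultimately have "g ` I = {0}" by (rule lie_semisimpleD[OF ss])
  then have "f ` g ` I = {0}" using linear_0[OF f(1)] by simp
  then show "I = {0}" by (simp add: image_image fg)
qed

text \<open>The algebra is perfect, so its derived series is constant, and a nonzero ideal contains
  one of the generators, hence by the cyclic brackets all of them. Arbitrary signs of the constants
  let one argument serve the compact and the noncompact forms.\<close>

lemma lie_semisimple_span_triple:
  assumes ab: "bracket a b = \<gamma> *\<^sub>R c" and bc: "bracket b c = \<alpha> *\<^sub>R a"
    and ca: "bracket c a = \<beta> *\<^sub>R b"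
    and nz: "\<alpha> \<noteq> 0" "\<beta> \<noteq> 0" "\<gamma> \<noteq> 0"
  shows "lie_semisimple (span {a, b, c})"
    and "\<And>x y. x \<in> span {a, b, c} \<Longrightarrow> y \<in> span {a, b, c} \<Longrightarrow> bracket x y \<in> span {a, b, c}"
proof -
  let ?v = "span {a, b, c}"
  have ba: "bracket b a = (- \<gamma>) *\<^sub>R c" and cb: "bracket c b = (- \<alpha>) *\<^sub>R a"
    and ac: "bracket a c = (- \<beta>) *\<^sub>R b"
    by (simp_all only: bracket_commute[of b a] bracket_commute[of c b] bracket_commute[of a c]
        ab bc ca scaleR_minus_left)
  note t = ab bc ca ba cb ac
  have repr: "\<exists>p q r. x = p *\<^sub>R a + q *\<^sub>R b + r *\<^sub>R c" if "x \<in> ?v" for x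
    using that by (rule span_tripleE) blast
  have mem: "p *\<^sub>R a + q *\<^sub>R b + r *\<^sub>R c \<in> ?v" for p q r
    by (intro span_add span_scale span_base) auto
  show cl: "bracket x y \<in> ?v" if "x \<in> ?v" "y \<in> ?v" for x y
  proof -
    obtain p q r p' q' r' where "x = p *\<^sub>R a + q *\<^sub>R b + r *\<^sub>R c"
      "y = p' *\<^sub>R a + q' *\<^sub>R b + r' *\<^sub>R c" using repr \<open>x \<in> ?v\<close> \<open>y \<in> ?v\<close> by metis
    then have "bracket x y = (\<alpha> * (q * r' - r * q')) *\<^sub>R a + (\<beta> * (r * p' - p * r')) *\<^sub>R b
        + (\<gamma> * (p * q' - q * p')) *\<^sub>R c"
      by (simp add: bracket_simps t algebra_simps)
    then show ?thesis using mem by simp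
  qed
  have der: "derived ?v = ?v"
  proof (rule subset_antisym)
    show "derived ?v \<subseteq> ?v" using subspace_span cl by (rule derived_subset)
    have in_v: "a \<in> ?v" "b \<in> ?v" "c \<in> ?v" by (auto intro: span_base)
    have "\<alpha> *\<^sub>R a \<in> derived ?v" "\<beta> *\<^sub>R b \<in> derived ?v" "\<gamma> *\<^sub>R c \<in> derived ?v"
      unfolding bc[symmetric] ca[symmetric] ab[symmetric] by (intro bracket_in_derived in_v)+
    then have "{a, b, c} \<subseteq> derived ?v"
      by (simp add: subspace_scaleR_iff[OF subspace_derived] nz)
    then show "?v \<subseteq> derived ?v" by (rule span_minimal[OF _ subspace_derived])
  qed
  have fp: "(derived ^^ n) ?v = ?v" for n by (induction n) (simp_all add: der)
  show "lie_semisimple ?v"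
    unfolding lie_semisimple_def
  proof (intro allI impI, elim conjE, rule ccontr)
    fix I assume I: "lie_ideal I ?v" "lie_solvable I" "I \<noteq> {0}"
    have sub: "subspace I" and Iv: "I \<subseteq> ?v"
      and id: "\<And>x y. x \<in> ?v \<Longrightarrow> y \<in> I \<Longrightarrow> bracket x y \<in> I"
      using I(1) unfolding lie_ideal_def by simp_all
    have in_v: "a \<in> ?v" "b \<in> ?v" "c \<in> ?v" by (auto intro: span_base)
    have sc: "x \<in> I" if "k *\<^sub>R x \<in> I" "k \<noteq> 0" for k x
      using sub that by (rule subspace_scaleR_cancel)
    have ia: "a \<in> I \<Longrightarrow> b \<in> I" and ib: "b \<in> I \<Longrightarrow> c \<in> I" and ic: "c \<in> I \<Longrightarrow> a \<in> I"
      using sc[of \<beta> b] sc[of \<gamma> c] sc[of \<alpha> a] nz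
        id[OF in_v(3), of a] id[OF in_v(1), of b] id[OF in_v(2), of c] by (simp_all only: t simp_thms)
    obtain x where x: "x \<in> I" "x \<noteq> 0" using I(3) subspace_0[OF sub] by auto
    obtain p q r where xe: "x = p *\<^sub>R a + q *\<^sub>R b + r *\<^sub>R c"
      using subsetD[OF Iv x(1)] by (rule span_tripleE)
    \<comment> \<open>Bracketing with \<open>a\<close> removes the \<open>a\<close> part and turns
      \<open>b\<close> into \<open>c\<close> and \<open>c\<close> into \<open>b\<close>; bracketing
      with \<open>b\<close> then leaves only a multiple of \<open>a\<close>. The other two follow
      cyclically.\<close>
    have "bracket b (bracket a x) \<in> I" "bracket c (bracket b x) \<in> I" "bracket a (bracket c x) \<in> I"
      by (intro id in_v x(1))+
    then have "(q * \<gamma> * \<alpha>) *\<^sub>R a \<in> I" "(r * \<alpha> * \<beta>) *\<^sub>R b \<in> I" "(p * \<beta> * \<gamma>) *\<^sub>R c \<in> I"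
      by (simp_all add: xe bracket_simps t mult_ac)
    then have "q \<noteq> 0 \<Longrightarrow> a \<in> I" "r \<noteq> 0 \<Longrightarrow> b \<in> I" "p \<noteq> 0 \<Longrightarrow> c \<in> I"
      using sc[of "q * \<gamma> * \<alpha>" a] sc[of "r * \<alpha> * \<beta>" b] sc[of "p * \<beta> * \<gamma>" c] nz by simp_all
    moreover have "p \<noteq> 0 \<or> q \<noteq> 0 \<or> r \<noteq> 0" using x(2) xe by auto
    ultimately have "a \<in> I \<and> b \<in> I \<and> c \<in> I" using ia ib ic by argo
    then have "?v \<subseteq> I" using sub by (intro span_minimal) auto
    then have "I = ?v" by (rule subset_antisym[OF Iv])
    then have "lie_solvable ?v" using I(2) by (simp only:)
    then obtain n where "(derived ^^ n) ?v = {0}" by (rule lie_solvableE)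
    then have "I = {0}" unfolding fp \<open>I = ?v\<close> .
    then show False using I(3) by contradiction
  qed
qed

section \<open>Three by three matrices\<close>

definition mat3 :: "complex \<Rightarrow> complex \<Rightarrow> complex \<Rightarrow> complex \<Rightarrow> complex \<Rightarrow> complex \<Rightarrow>
    complex \<Rightarrow> complex \<Rightarrow> complex \<Rightarrow> complex^3^3" where
  "mat3 a b c d e f g h i = vector [vector [a, b, c], vector [d, e, f], vector [g, h, i]]"

lemma mat3_nth:
  "mat3 a b c d e f g h i $ 1 $ 1 = a" "mat3 a b c d e f g h i $ 1 $ 2 = b" "mat3 a b c d e f g h i $ 1 $ 3 = c"
  "mat3 a b c d e f g h i $ 2 $ 1 = d" "mat3 a b c d e f g h i $ 2 $ 2 = e" "mat3 a b c d e f g h i $ 2 $ 3 = f"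
  "mat3 a b c d e f g h i $ 3 $ 1 = g" "mat3 a b c d e f g h i $ 3 $ 2 = h" "mat3 a b c d e f g h i $ 3 $ 3 = i"
  by (simp_all add: mat3_def)

lemma mat3_eta:
  "mat3 (A$1$1) (A$1$2) (A$1$3) (A$2$1) (A$2$2) (A$2$3) (A$3$1) (A$3$2) (A$3$3) = A"
  by (simp add: vec_eq_iff forall_3 mat3_nth)

lemma mat3E:
  obtains a b c d e f g h i where "A = mat3 a b c d e f g h i"
  using mat3_eta by metis

lemma mat3_eq_iff:
  "mat3 a b c d e f g h i = mat3 a' b' c' d' e' f' g' h' i' \<longleftrightarrow>
    a = a' \<and> b = b' \<and> c = c' \<and> d = d' \<and> e = e' \<and> f = f' \<and> g = g' \<and> h = h' \<and> i = i'"
  by (auto simp: vec_eq_iff forall_3 mat3_nth)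

lemma mat3_mult:
  "mat3 a b c d e f g h i ** mat3 a' b' c' d' e' f' g' h' i' =
    mat3 (a*a' + b*d' + c*g') (a*b' + b*e' + c*h') (a*c' + b*f' + c*i')
         (d*a' + e*d' + f*g') (d*b' + e*e' + f*h') (d*c' + e*f' + f*i')
         (g*a' + h*d' + i*g') (g*b' + h*e' + i*h') (g*c' + h*f' + i*i')"
  by (simp add: vec_eq_iff forall_3 mat3_nth matrix_matrix_mult_def sum_3)

lemma mat3_add:
  "mat3 a b c d e f g h i + mat3 a' b' c' d' e' f' g' h' i' =
    mat3 (a+a') (b+b') (c+c') (d+d') (e+e') (f+f') (g+g') (h+h') (i+i')"
  and mat3_diff:
  "mat3 a b c d e f g h i - mat3 a' b' c' d' e' f' g' h' i' =
    mat3 (a-a') (b-b') (c-c') (d-d') (e-e') (f-f') (g-g') (h-h') (i-i')"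
  and mat3_minus: "- mat3 a b c d e f g h i = mat3 (-a) (-b) (-c) (-d) (-e) (-f) (-g) (-h) (-i)"
  and mat3_scaleR: "k *\<^sub>R mat3 a b c d e f g h i =
    mat3 (k*a) (k*b) (k*c) (k*d) (k*e) (k*f) (k*g) (k*h) (k*i)"
  and mat3_zero: "0 = mat3 0 0 0 0 0 0 0 0 0"
  and mat3_one: "mat \<omega> = mat3 \<omega> 0 0 0 \<omega> 0 0 0 \<omega>"
  by (simp_all add: vec_eq_iff forall_3 mat3_nth scaleR_conv_of_real[where 'a = complex] mat_def)

lemma mat3_conj_transpose:
  "conj_transpose (mat3 a b c d e f g h i) =
    mat3 (cnj a) (cnj d) (cnj g) (cnj b) (cnj e) (cnj h) (cnj c) (cnj f) (cnj i)"
  by (simp add: vec_eq_iff forall_3 mat3_nth conj_transpose_def transpose_def map_matrix_def)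

lemma trace_mat3: "trace (mat3 a b c d e f g h i) = a + e + i"
  by (simp add: trace_def sum_3 mat3_nth)

lemma det_mat3: "det (mat3 a b c d e f g h i) =
    a * e * i + b * f * g + c * d * h - a * f * h - b * d * i - c * e * g"
  by (simp add: det_3 mat3_nth)

lemmas mat3_simps = mat3_mult mat3_add mat3_diff mat3_minus mat3_scaleR mat3_zero mat3_one
  mat3_conj_transpose trace_mat3 det_mat3 mat3_eq_iff

lemma matrix_unit_mat3:
  "matrix_unit 1 1 = mat3 1 0 0 0 0 0 0 0 0" "matrix_unit 1 2 = mat3 0 1 0 0 0 0 0 0 0"
  "matrix_unit 1 3 = mat3 0 0 1 0 0 0 0 0 0" "matrix_unit 2 1 = mat3 0 0 0 1 0 0 0 0 0"
  "matrix_unit 2 2 = mat3 0 0 0 0 1 0 0 0 0" "matrix_unit 2 3 = mat3 0 0 0 0 0 1 0 0 0"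
  "matrix_unit 3 1 = mat3 0 0 0 0 0 0 1 0 0" "matrix_unit 3 2 = mat3 0 0 0 0 0 0 0 1 0"
  "matrix_unit 3 3 = mat3 0 0 0 0 0 0 0 0 1"
  by (simp_all add: vec_eq_iff forall_3 mat3_nth matrix_unit_def)

lemma itimes_mat3: "itimes (mat3 a b c d e f g h i) =
    mat3 (\<i>*a) (\<i>*b) (\<i>*c) (\<i>*d) (\<i>*e) (\<i>*f) (\<i>*g) (\<i>*h) (\<i>*i)"
  by (simp add: vec_eq_iff forall_3 mat3_nth itimes_def map_matrix_def)

lemma N21_mat3: "N21 = mat3 1 0 0 0 1 0 0 0 (-1)"
  by (simp add: N21_def matrix_unit_mat3 mat3_simps)

lemma A_mat3:
  "A1 = mat3 \<i> 0 0 0 (-\<i>) 0 0 0 0" "A2 = mat3 0 0 0 0 \<i> 0 0 0 (-\<i>)"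
  "A3 = mat3 0 1 0 (-1) 0 0 0 0 0" "A4 = mat3 0 \<i> 0 \<i> 0 0 0 0 0"
  "A5 = mat3 0 0 1 0 0 0 1 0 0" "A6 = mat3 0 0 \<i> 0 0 0 (-\<i>) 0 0"
  "A7 = mat3 0 0 0 0 0 1 0 1 0"
  by (simp_all add: A1_def A2_def A3_def A4_def A5_def A6_def A7_def matrix_unit_mat3
      itimes_mat3 mat3_simps)

lemma conj_transpose_mult: "conj_transpose (A ** B) = conj_transpose B ** conj_transpose A"
  for A B :: "complex^3^3"
  by (cases A rule: mat3E, cases B rule: mat3E) (simp add: mat3_simps algebra_simps)

lemma det_conj_transpose: "det (conj_transpose A) = cnj (det A)"
  for A :: "complex^3^3"
  by (cases A rule: mat3E) (simp add: mat3_simps algebra_simps)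

lemma trace_mult_commute: "trace (A ** B) = trace (B ** A)"
  for A B :: "complex^3^3"
  by (cases A rule: mat3E, cases B rule: mat3E) (simp add: mat3_simps algebra_simps)

lemma matrix_inv_eqI:
  assumes "A ** B = mat 1" "B ** A = mat 1"
  shows "matrix_inv A = (B :: complex^3^3)"
proof -
  have "A ** matrix_inv A = mat 1 \<and> matrix_inv A ** A = mat 1"
    unfolding matrix_inv_def by (rule someI[of _ B]) (use assms in simp)
  then have "matrix_inv A = (B ** A) ** matrix_inv A" "B ** (A ** matrix_inv A) = B"
    using assms(2) by simp_all
  then show ?thesis by (simp add: matrix_mul_assoc)
qed

lemma N21_square: "N21 ** N21 = mat 1"
  by (simp add: N21_mat3 mat3_simps)

lemma matrix_inv_N21: "matrix_inv N21 = N21"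
  by (rule matrix_inv_eqI) (rule N21_square)+

section \<open>Unitary frames\<close>

text \<open>The traceless matrices that are skew for the Hermitian form with Gram matrix
  \<open>M\<close>, written without an inverse of \<open>M\<close>.\<close>

definition su_form :: "complex^3^3 \<Rightarrow> (complex^3^3) set" where
  "su_form M = {X. trace X = 0 \<and> conj_transpose X ** M + M ** X = 0}"

lemma su21_eq_su_form: "su21 = su_form N21"
proof -
  have "- (N21 ** conj_transpose X ** N21) = X \<longleftrightarrow> conj_transpose X ** N21 + N21 ** X = 0" for X
  proof -
    have "conj_transpose X ** N21 + N21 ** X = 0
        \<longleftrightarrow> N21 ** (conj_transpose X ** N21 + N21 ** X) = 0"
      by (cases "conj_transpose X ** N21 + N21 ** X" rule: mat3E) (simp add: N21_mat3 mat3_simps)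
    also have "\<dots> \<longleftrightarrow> N21 ** conj_transpose X ** N21 + X = 0"
      by (simp add: matrix_add_ldistrib matrix_mul_assoc N21_square)
    also have "\<dots> \<longleftrightarrow> - (N21 ** conj_transpose X ** N21) = X"
      by (metis add_eq_0_iff minus_minus)
    finally show ?thesis by simp
  qed
  then show ?thesis by (simp add: su21_def su_form_def matrix_inv_N21)
qed

text \<open>The columns of \<^term>\<open>P\<close> form a basis with Gram matrix \<^term>\<open>M\<close>.\<close>

definition frame :: "complex^3^3 \<Rightarrow> complex^3^3 \<Rightarrow> complex^3^3 \<Rightarrow> bool" where
  "frame M P Q \<longleftrightarrow> P ** Q = mat 1 \<and> Q ** P = mat 1 \<and> conj_transpose P ** N21 ** P = M"

lemma frameI:
  assumes "conj_transpose P ** N21 ** P = M" "det M \<noteq> 0"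
  obtains Q where "frame M P Q"
proof -
  have "det P \<noteq> 0" using assms by (auto simp: det_mul)
  then obtain Q where "P ** Q = mat 1" "Q ** P = mat 1"
    using invertible_det_nz[of P] unfolding invertible_def by metis
  then show ?thesis using assms(1) that unfolding frame_def by metis
qed

text \<open>\<open>Q ** x ** P\<close> is the matrix of \<open>x\<close> in the basis of columns of
  \<open>P\<close>, so it is skew for the Gram matrix of that basis.\<close>

lemma frame_pullback:
  assumes "frame M P Q" "x \<in> su21"
  shows "Q ** x ** P \<in> su_form M"
proof -
  have PQ: "P ** Q = mat 1" and M: "M = conj_transpose P ** N21 ** P"
    using assms(1) unfolding frame_def by simp_all
  have "trace (Q ** x ** P) = trace (P ** (Q ** x))" by (rule trace_mult_commute)
  also have "\<dots> = trace x" by (simp add: matrix_mul_assoc PQ)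
  also have "\<dots> = 0" using assms(2) by (simp add: su21_eq_su_form su_form_def)
  finally have tr: "trace (Q ** x ** P) = 0" .
  have QP': "conj_transpose Q ** conj_transpose P = mat 1"
    unfolding conj_transpose_mult[symmetric] PQ by (simp add: mat3_simps)
  have "conj_transpose (Q ** x ** P) ** M
      = conj_transpose P ** conj_transpose x ** (conj_transpose Q ** conj_transpose P) ** N21 ** P"
    by (simp only: M conj_transpose_mult matrix_mul_assoc)
  also have "\<dots> = conj_transpose P ** (conj_transpose x ** N21) ** P"
    by (simp add: QP' matrix_mul_assoc)
  finally have 1: "conj_transpose (Q ** x ** P) ** M = conj_transpose P ** (conj_transpose x ** N21) ** P" .
  have "M ** (Q ** x ** P) = conj_transpose P ** N21 ** (P ** Q) ** x ** P"
    by (simp only: M matrix_mul_assoc)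
  then have 2: "M ** (Q ** x ** P) = conj_transpose P ** (N21 ** x) ** P"
    by (simp add: PQ matrix_mul_assoc)
  have "conj_transpose x ** N21 + N21 ** x = 0"
    using assms(2) by (simp add: su21_eq_su_form su_form_def)
  then have "conj_transpose (Q ** x ** P) ** M + M ** (Q ** x ** P) = 0"
    unfolding 1 2 matrix_add_ldistrib[symmetric] matrix_add_left[symmetric] by simp
  then show ?thesis using tr by (simp add: su_form_def)
qed

lemma mat_commute: "mat \<omega> ** A = A ** mat \<omega>" for A :: "complex^3^3"
  by (cases A rule: mat3E) (simp add: mat3_simps)

lemma mat_left_commute: "A ** (mat \<omega> ** B) = mat \<omega> ** (A ** B)" for A B :: "complex^3^3"
  unfolding matrix_mul_assoc mat_commute[of \<omega> A] ..

lemma mat_mult_mat: "mat a ** mat b = (mat (a * b) :: complex^3^3)"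
  by (simp add: mat3_simps)

lemma conj_transpose_mat: "conj_transpose (mat a :: complex^3^3) = mat (cnj a)"
  by (simp add: mat3_simps)

lemma SU21I:
  assumes "det g = 1" "conj_transpose g ** N21 ** g = N21"
  shows "g \<in> SU21"
proof -
  have 1: "(N21 ** g ** N21) ** conj_transpose g = mat 1"
  proof -
    have "(N21 ** (conj_transpose g ** N21)) ** g = mat 1"
      using arg_cong[OF assms(2), of "\<lambda>X. N21 ** X"] by (simp add: N21_square matrix_mul_assoc)
    then have "g ** (N21 ** (conj_transpose g ** N21)) = mat 1"
      by (simp add: matrix_left_right_inverse)
    then have "N21 ** (g ** (N21 ** (conj_transpose g ** N21))) ** N21 = mat 1"
      by (simp add: N21_square)
    then show ?thesis by (simp add: matrix_mul_assoc[symmetric] N21_square)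
  qed
  then have "conj_transpose g ** (N21 ** g ** N21) = mat 1"
    by (simp add: matrix_left_right_inverse)
  then have "matrix_inv (conj_transpose g) = N21 ** g ** N21"
    using 1 by (rule matrix_inv_eqI)
  moreover have "N21 ** (N21 ** g ** N21) ** N21 = (N21 ** N21) ** g ** (N21 ** N21)"
    by (simp only: matrix_mul_assoc)
  ultimately show ?thesis
    using assms(1) by (simp add: SU21_def matrix_inv_N21 N21_square)
qed

text \<open>Multiplying an isometry by a unit scalar \<omega> multiplies its determinant by the cube
  of \<omega> and leaves conjugation unchanged; this is how determinant one is reached.\<close>

lemma unit_cube_root:
  assumes "cmod d = 1"
  obtains \<omega> where "\<omega> ^ 3 * d = 1" "\<omega> * cnj \<omega> = 1"
proof -
  obtain t where t: "d = cis t" using assms by (metis complex_norm_eq_1_exp cis_conv_exp)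
  show ?thesis
  proof (rule that[of "cis (- t / 3)"])
    have "cis (- t / 3) ^ 3 = cis (- t)" by (simp add: Complex.DeMoivre)
    then show "cis (- t / 3) ^ 3 * d = 1" by (simp add: t cis_mult)
    show "cis (- t / 3) * cnj (cis (- t / 3)) = 1" by (simp add: cis_cnj cis_mult)
  qed
qed

text \<open>The map \<open>h\<close> that carries the first basis to the second preserves the form
  because the Gram matrices agree. Its determinant has modulus one, and a unit scalar makes it
  one.\<close>

lemma SU21_conjugate_frames:
  assumes F: "frame M P Q" "frame M P' Q'"
    and eq: "(\<lambda>x. Q ** x ** P) ` v = (\<lambda>x. Q' ** x ** P') ` v'"
  shows "SU21_conjugate v v'"
proof -
  have PQ: "P ** Q = mat 1" "Q ** P = mat 1" and M: "conj_transpose P ** N21 ** P = M"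
    and PQ': "P' ** Q' = mat 1" "Q' ** P' = mat 1" and M': "conj_transpose P' ** N21 ** P' = M"
    using F unfolding frame_def by simp_all
  define h where "h = P' ** Q"
  define k where "k = P ** Q'"
  have hk: "h ** k = mat 1"
    using arg_cong[OF PQ(2), of "\<lambda>X. P' ** X ** Q'"]
    by (simp add: h_def k_def matrix_mul_assoc PQ')
  have "conj_transpose h ** N21 ** h = conj_transpose Q ** (conj_transpose P' ** N21 ** P') ** Q"
    by (simp only: h_def conj_transpose_mult matrix_mul_assoc)
  also have "\<dots> = conj_transpose (P ** Q) ** N21 ** (P ** Q)"
    by (simp only: M' M[symmetric] conj_transpose_mult matrix_mul_assoc)
  finally have hN: "conj_transpose h ** N21 ** h = N21"
    by (simp add: PQ conj_transpose_mat)
  have "cnj (det h) * det N21 * det h = det N21"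
    using arg_cong[OF hN, of det] by (simp add: det_mul det_conj_transpose)
  moreover have "det N21 = -1" by (simp add: N21_mat3 mat3_simps)
  ultimately have "det h * cnj (det h) = 1" by (simp add: mult.commute)
  then have "cmod (det h) ^ 2 = 1" by (metis complex_mod_mult_cnj norm_one)
  then have "cmod (det h) = 1" using norm_ge_zero[of "det h"] by (auto simp: power2_eq_1_iff)
  then obtain \<omega> where w: "\<omega> ^ 3 * det h = 1" "\<omega> * cnj \<omega> = 1" by (rule unit_cube_root)
  define g where "g = mat \<omega> ** h"
  \<comment> \<open>As \<omega> has modulus one, \<open>cnj \<omega>\<close> is its inverse, so
    \<open>g'\<close> is the inverse of \<open>g\<close>.\<close>
  define g' where "g' = mat (cnj \<omega>) ** k"
  have gg: "g ** g' = mat 1"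
  proof -
    have "g ** g' = mat \<omega> ** (h ** (mat (cnj \<omega>) ** k))"
      by (simp only: g_def g'_def matrix_mul_assoc)
    also have "\<dots> = mat (\<omega> * cnj \<omega>) ** (h ** k)"
      unfolding mat_left_commute[of h] unfolding matrix_mul_assoc mat_mult_mat ..
    finally have "g ** g' = mat (\<omega> * cnj \<omega>) ** (h ** k)" .
    then show ?thesis by (simp add: w hk)
  qed
  then have inv: "matrix_inv g = g'"
    by (rule matrix_inv_eqI[OF _ gg[unfolded matrix_left_right_inverse[of g]]])
  have "g \<in> SU21"
  proof (rule SU21I)
    have "det (mat \<omega> :: complex^3^3) = \<omega> ^ 3" by (simp add: mat3_simps power3_eq_cube)
    then show "det g = 1" using w by (simp add: g_def det_mul)
    have "conj_transpose g ** N21 ** g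
        = conj_transpose h ** (mat (cnj \<omega>) ** (N21 ** (mat \<omega> ** h)))"
      by (simp only: g_def conj_transpose_mult conj_transpose_mat matrix_mul_assoc)
    also have "\<dots> = mat (cnj \<omega> * \<omega>) ** (conj_transpose h ** N21 ** h)"
      unfolding mat_left_commute[of "conj_transpose h"] mat_left_commute[of N21]
      unfolding matrix_mul_assoc mat_mult_mat ..
    finally show "conj_transpose g ** N21 ** g = N21"
      using w(2) hN by (simp add: mult.commute)
  qed
  moreover have "v' = (\<lambda>x. g ** x ** matrix_inv g) ` v"
  proof -
    have cong: "g ** x ** matrix_inv g = P' ** (Q ** x ** P) ** Q'" for x
    proof -
      have "g ** x ** matrix_inv g = mat \<omega> ** (h ** (x ** (mat (cnj \<omega>) ** k)))"
        unfolding inv by (simp only: g_def g'_def matrix_mul_assoc)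
      also have "\<dots> = mat (\<omega> * cnj \<omega>) ** (h ** (x ** k))"
        unfolding mat_left_commute[of h] mat_left_commute[of x]
        unfolding matrix_mul_assoc mat_mult_mat ..
      finally show ?thesis
        by (simp add: mat_mult_mat w h_def k_def matrix_mul_assoc)
    qed
    have conj_inv: "P' ** (Q' ** x ** P') ** Q' = x" for x
    proof -
      have "P' ** (Q' ** x ** P') ** Q' = (P' ** Q') ** x ** (P' ** Q')"
        by (simp only: matrix_mul_assoc)
      then show ?thesis by (simp add: PQ'(1))
    qed
    have "(\<lambda>x. g ** x ** matrix_inv g) ` v = (\<lambda>y. P' ** y ** Q') ` (\<lambda>x. Q ** x ** P) ` v"
      unfolding cong image_image ..
    also have "\<dots> = v'" unfolding eq image_image conj_inv by simp
    finally show ?thesis by (rule sym)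
  qed
  ultimately show ?thesis unfolding SU21_conjugate_def by (rule rev_bexI)
qed

section \<open>Coordinates on the two forms of the algebra\<close>

text \<open>
  \<^term>\<open>J21\<close> is the Gram matrix of a basis \<open>e, m, f\<close> with \<open>e, f\<close> isotropic and paired to 1 and \<open>m\<close> a
  unit vector orthogonal to both.
\<close>

definition J21 :: "complex^3^3" where
  "J21 = mat3 0 0 1 0 1 0 1 0 0"

text \<open>Coordinates adapted to the restricted roots: \<open>c\<close> is the diagonal part,
  \<open>b\<close> and \<open>g\<close> range over the two-dimensional spaces of a root and its
  negative, \<open>s\<close> and \<open>t\<close> over the one-dimensional spaces of the doubled
  roots.\<close>

definition mk :: "complex \<Rightarrow> complex \<Rightarrow> complex \<Rightarrow> real \<Rightarrow> real \<Rightarrow> complex^3^3" where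
  "mk c b g s t = mat3 c b (\<i> * s) g (cnj c - c) (- cnj b) (\<i> * t) (- cnj g) (- cnj c)"

text \<open>The entries \<open>x\<close>, \<open>y\<close>, \<open>w\<close> form the compact part
  u(2); \<open>u\<close> and \<open>v\<close> are the noncompact entries, the only ones that
  contribute positively to the trace of the square.\<close>

definition nk :: "real \<Rightarrow> real \<Rightarrow> complex \<Rightarrow> complex \<Rightarrow> complex \<Rightarrow> complex^3^3" where
  "nk x y w u v = mat3 (\<i> * x) w u (- cnj w) (\<i> * y) v (cnj u) (cnj v) (- \<i> * (x + y))"

lemma su_form_J21E:
  assumes "X \<in> su_form J21"
  obtains c b g s t where "X = mk c b g s t"
proof -
  obtain a1 a2 a3 a4 a5 a6 a7 a8 a9 where X: "X = mat3 a1 a2 a3 a4 a5 a6 a7 a8 a9" by (rule mat3E)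
  have "X = mk a1 a2 a4 (Im a3) (Im a7)"
    unfolding X mk_def mat3_eq_iff complex_eq_iff
    using assms[unfolded X su_form_def J21_def mat3_simps mem_Collect_eq complex_eq_iff, simplified]
    by (intro conjI; (simp (no_asm))?; linarith?)
  then show ?thesis by (rule that)
qed

lemma su_form_N21E:
  assumes "X \<in> su_form N21"
  obtains x y w u v where "X = nk x y w u v"
proof -
  obtain a1 a2 a3 a4 a5 a6 a7 a8 a9 where X: "X = mat3 a1 a2 a3 a4 a5 a6 a7 a8 a9" by (rule mat3E)
  have "X = nk (Im a1) (Im a5) a2 a3 a6"
    unfolding X nk_def mat3_eq_iff complex_eq_iff
    using assms[unfolded X su_form_def N21_mat3 mat3_simps mem_Collect_eq complex_eq_iff, simplified]
    by (intro conjI; (simp (no_asm))?; linarith?)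
  then show ?thesis by (rule that)
qed

lemma nk_in_su21: "nk x y w u v \<in> su21"
  by (simp add: su21_eq_su_form su_form_def N21_mat3 mat3_simps nk_def complex_eq_iff)

lemma mk_eq_iff: "mk c b g s t = mk c' b' g' s' t' \<longleftrightarrow> c = c' \<and> b = b' \<and> g = g' \<and> s = s' \<and> t = t'"
  by (auto simp: mk_def mat3_eq_iff)

lemma mk_zero: "0 = mk 0 0 0 0 0"
  and mk_add: "mk c b g s t + mk c' b' g' s' t' = mk (c + c') (b + b') (g + g') (s + s') (t + t')"
  and mk_diff: "mk c b g s t - mk c' b' g' s' t' = mk (c - c') (b - b') (g - g') (s - s') (t - t')"
  and mk_scaleR: "k *\<^sub>R mk c b g s t = mk (k * c) (k * b) (k * g) (k * s) (k * t)"
  by (simp_all add: mk_def mat3_simps algebra_simps)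

text \<open>The factor \<open>2 * c - cnj c\<close> is the difference of the first two diagonal
  entries. A diagonal element acts by it on \<open>b\<close>, by its negative on \<open>g\<close>,
  and by the real numbers \<open>2 * Re c\<close> and \<open>- 2 * Re c\<close> on \<open>s\<close>
  and \<open>t\<close>.\<close>

lemma mk_bracket:
  "bracket (mk c b g s t) (mk c' b' g' s' t') =
    mk (b * g' - b' * g - s * t' + s' * t)
       ((2 * c - cnj c) * b' - (2 * c' - cnj c') * b - \<i> * s * cnj g' + \<i> * s' * cnj g)
       ((2 * c' - cnj c') * g - (2 * c - cnj c) * g' - \<i> * t' * cnj b + \<i> * t * cnj b')
       (2 * Re c * s' - 2 * Re c' * s + 2 * Im (b' * cnj b))
       (2 * Re c' * t - 2 * Re c * t' + 2 * Im (g * cnj g'))"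
  by (simp add: bracket_def mk_def mat3_simps) (simp add: complex_eq_iff algebra_simps)

lemma nk_zero: "0 = nk 0 0 0 0 0"
  and nk_add: "nk x y w u v + nk x' y' w' u' v' = nk (x + x') (y + y') (w + w') (u + u') (v + v')"
  and nk_diff: "nk x y w u v - nk x' y' w' u' v' = nk (x - x') (y - y') (w - w') (u - u') (v - v')"
  and nk_scaleR: "k *\<^sub>R nk x y w u v = nk (k * x) (k * y) (k * w) (k * u) (k * v)"
  by (simp_all add: nk_def mat3_simps algebra_simps)

lemma nk_eq_iff: "nk x y w u v = nk x' y' w' u' v' \<longleftrightarrow> x = x' \<and> y = y' \<and> w = w' \<and> u = u' \<and> v = v'"
  by (auto simp: nk_def mat3_eq_iff)

lemma nk_bracket:
  "bracket (nk x y w u v) (nk x' y' w' u' v') =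
    nk (2 * Im (w' * cnj w) + 2 * Im (u * cnj u'))
       (2 * Im (w * cnj w') + 2 * Im (v * cnj v'))
       (\<i> * (x - y) * w' - \<i> * (x' - y') * w + u * cnj v' - u' * cnj v)
       (\<i> * (2 * x + y) * u' - \<i> * (2 * x' + y') * u + w * v' - w' * v)
       (\<i> * (x + 2 * y) * v' - \<i> * (x' + 2 * y') * v - cnj w * u' + cnj w' * u)"
  by (simp add: bracket_def nk_def mat3_simps) (simp add: complex_eq_iff algebra_simps)

lemma trace_mk_mult: "trace (mk c b g s t ** mk c' b' g' s' t') =
    complex_of_real (2 * Re (c * c') - 4 * Im c * Im c' + 2 * Re (b * g') + 2 * Re (b' * g) - s * t' - s' * t)"
  by (simp add: mk_def mat3_simps) (simp add: complex_eq_iff algebra_simps)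

lemma trace_nk_mult: "trace (nk x y w u v ** nk x' y' w' u' v') =
    complex_of_real (- 2 * x * x' - 2 * y * y' - x * y' - x' * y - 2 * Re (w * cnj w')
      + 2 * Re (u * cnj u') + 2 * Re (v * cnj v'))"
  by (simp add: nk_def mat3_simps) (simp add: complex_eq_iff algebra_simps)

lemma trace_mk_square: "trace (mk c b g s t ** mk c b g s t) =
    complex_of_real (2 * (Re c)\<^sup>2 - 6 * (Im c)\<^sup>2 + 4 * Re (b * g) - 2 * s * t)"
  by (simp add: trace_mk_mult power2_eq_square)

lemma trace_nk_square: "trace (nk x y w u v ** nk x y w u v) =
    complex_of_real (- x\<^sup>2 - y\<^sup>2 - (x + y)\<^sup>2 - 2 * (cmod w)\<^sup>2 + 2 * (cmod u)\<^sup>2 + 2 * (cmod v)\<^sup>2)"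
  by (simp add: trace_nk_mult cmod_power2 complex_eq_iff) (simp add: power2_eq_square algebra_simps)

section \<open>The Hermitian form and adapted frames\<close>

definition herm :: "complex^3 \<Rightarrow> complex^3 \<Rightarrow> complex" where
  "herm u v = u$1 * cnj (v$1) + u$2 * cnj (v$2) - u$3 * cnj (v$3)"

lemma vec3_eq_iff: "u = v \<longleftrightarrow> u$1 = v$1 \<and> u$2 = v$2 \<and> u$3 = v$3" for u v :: "complex^3"
  by (simp add: vec_eq_iff forall_3)

lemma mat3_mult_vec: "(mat3 a b c d e f g h i *v u) $ 1 = a * u$1 + b * u$2 + c * u$3"
  "(mat3 a b c d e f g h i *v u) $ 2 = d * u$1 + e * u$2 + f * u$3"
  "(mat3 a b c d e f g h i *v u) $ 3 = g * u$1 + h * u$2 + i * u$3"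
  by (simp_all add: matrix_vector_mult_def sum_3 mat3_nth)

lemma herm_scale_left: "herm (k *s u) v = k * herm u v"
  and herm_scale_right: "herm u (k *s v) = cnj k * herm u v"
  and herm_commute: "herm v u = cnj (herm u v)"
  by (simp_all add: herm_def algebra_simps)

lemma herm_self: "herm u u = complex_of_real ((cmod (u$1))\<^sup>2 + (cmod (u$2))\<^sup>2 - (cmod (u$3))\<^sup>2)"
  by (simp add: herm_def complex_norm_square del: of_real_power)

lemma herm_skew:
  assumes "z \<in> su21"
  shows "herm (z *v u) v = - herm u (z *v v)"
proof -
  obtain x y w p q where "z = nk x y w p q" using assms su21_eq_su_form su_form_N21E by metis
  then show ?thesis by (simp add: nk_def herm_def mat3_mult_vec algebra_simps)
qed

text \<open>The conjugated cross product with its index lowered by the form, hence the sign of the last entry.\<close>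

definition cross :: "complex^3 \<Rightarrow> complex^3 \<Rightarrow> complex^3" where
  "cross u v = vector [cnj (u$2 * v$3 - u$3 * v$2), cnj (u$3 * v$1 - u$1 * v$3), - cnj (u$1 * v$2 - u$2 * v$1)]"

text \<open>The last identity is Lagrange's, with the sign reversed by the signature. The completing
  vector is therefore positive for an isotropic pair and negative for an orthonormal one, as both
  frames below require.\<close>

lemma herm_cross: "herm u (cross u v) = 0" "herm v (cross u v) = 0"
  "herm (cross u v) u = 0" "herm (cross u v) v = 0"
  "herm (cross u v) (cross u v) = herm u v * herm v u - herm u u * herm v v"
  by (simp_all add: herm_def cross_def algebra_simps)

definition columns3 :: "complex^3 \<Rightarrow> complex^3 \<Rightarrow> complex^3 \<Rightarrow> complex^3^3" where
  "columns3 p q r = mat3 (p$1) (q$1) (r$1) (p$2) (q$2) (r$2) (p$3) (q$3) (r$3)"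

lemma columns3_axis: "columns3 p q r *v axis 1 1 = p" "columns3 p q r *v axis 2 1 = q"
  "columns3 p q r *v axis 3 1 = r"
  by (simp_all add: columns3_def vec3_eq_iff mat3_mult_vec axis_def)

lemma gram_columns3: "conj_transpose (columns3 p q r) ** N21 ** columns3 p q r =
    mat3 (herm p p) (herm q p) (herm r p) (herm p q) (herm q q) (herm r q) (herm p r) (herm q r) (herm r r)"
  by (simp add: columns3_def N21_mat3 mat3_simps herm_def algebra_simps)

lemma null_frame:
  assumes "herm e e = 0" "herm f f = 0" "herm e f = 1"
  obtains P Q where "frame J21 P Q" "P *v axis 1 1 = e" "P *v axis 3 1 = f"
proof -
  define P where "P = columns3 e (cross e f) f"
  have "conj_transpose P ** N21 ** P = J21"
    using assms herm_commute[of f e] by (simp add: P_def gram_columns3 herm_cross J21_def)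
  moreover have "det J21 \<noteq> 0" by (simp add: J21_def mat3_simps)
  ultimately obtain Q where "frame J21 P Q" by (rule frameI)
  then show ?thesis using that by (simp add: P_def columns3_axis)
qed

lemma orthonormal_frame:
  assumes "herm p p = 1" "herm q q = 1" "herm p q = 0"
  obtains P Q where "frame N21 P Q" "P *v axis 1 1 = p" "P *v axis 2 1 = q"
proof -
  define P where "P = columns3 p q (cross p q)"
  have "conj_transpose P ** N21 ** P = N21"
    unfolding P_def gram_columns3
    using assms herm_commute[of q p] by (simp add: herm_cross N21_mat3)
  moreover have "det N21 \<noteq> 0" by (simp add: N21_mat3 mat3_simps)
  ultimately obtain Q where "frame N21 P Q" by (rule frameI)
  then show ?thesis using that by (simp add: P_def columns3_axis)
qed

lemma frame_eigenvector:
  assumes "frame M P Q" "P *v a = e" "z *v e = k *s e"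
  shows "(Q ** z ** P) *v a = k *s a"
proof -
  have QP: "Q ** P = mat 1" using assms(1) unfolding frame_def by simp
  have "(Q ** z ** P) *v a = Q *v (z *v (P *v a))"
    by (simp only: matrix_vector_mul_assoc matrix_mul_assoc)
  also have "\<dots> = Q *v (P *v (k *s a))"
    unfolding assms(2,3) by (simp add: assms(2)[symmetric] vec.scale)
  also have "\<dots> = k *s a"
    by (simp add: matrix_vector_mul_assoc QP)
  finally show ?thesis .
qed

text \<open>Changing the sign of the third coordinate keeps a vector isotropic, and pairs
  \<open>e\<close> with its image to the Euclidean square norm \<open>d\<close>.\<close>

lemma isotropic_complement:
  assumes "herm e e = 0" "e \<noteq> 0"
  obtains f where "herm f f = 0" "herm e f = 1"
proof -
  define d where "d = (cmod (e$1))\<^sup>2 + (cmod (e$2))\<^sup>2 + (cmod (e$3))\<^sup>2"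
  define f :: "complex^3" where "f = complex_of_real (1 / d) *s vector [e$1, e$2, - e$3]"
  have "d \<noteq> 0"
    using assms(2) by (simp add: d_def vec3_eq_iff add_nonneg_eq_0_iff)
  have "herm f f = complex_of_real (1 / d\<^sup>2) * herm e e"
    by (simp add: f_def herm_def power2_eq_square algebra_simps)
  then have "herm f f = 0" using assms(1) by simp
  moreover have "herm e f = 1"
  proof -
    have d: "complex_of_real d = e$1 * cnj (e$1) + e$2 * cnj (e$2) + e$3 * cnj (e$3)"
      unfolding d_def of_real_add complex_norm_square ..
    have "herm e f = complex_of_real (1 / d) * complex_of_real d"
      unfolding d by (simp only: f_def herm_def vector_smult_component vector_3 complex_cnj_mult
          complex_cnj_complex_of_real complex_cnj_minus) (simp only: ring_distribs mult_ac diff_conv_add_uminus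
          mult_minus_right mult_minus_left minus_minus)
    then show ?thesis using \<open>d \<noteq> 0\<close> by (simp add: of_real_mult[symmetric] del: of_real_mult)
  qed
  ultimately show ?thesis by (rule that)
qed

text \<open>In signature (2,1) no plane is totally isotropic: it would contain a nonzero vector with
  third coordinate zero, where the form is positive definite.\<close>

lemma isotropic_orthogonal:
  assumes "herm e e = 0" "herm f f = 0" "herm e f = 0" "e \<noteq> 0"
  obtains k where "f = k *s e"
proof -
  have n: "(cmod (u$1))\<^sup>2 + (cmod (u$2))\<^sup>2 = (cmod (u$3))\<^sup>2" if "herm u u = 0" for u :: "complex^3"
    using that unfolding herm_self of_real_eq_0_iff by simp
  have e3: "e$3 \<noteq> 0"
    using n[OF assms(1)] assms(4) by (auto simp: vec3_eq_iff add_nonneg_eq_0_iff)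
  define k where "k = f$3 / e$3"
  define d where "d = f - k *s e"
  have "herm d d = herm f f - cnj k * herm f e - k * herm e f + k * cnj k * herm e e"
    by (simp add: d_def herm_def algebra_simps)
  then have "herm d d = 0"
    using assms(1-3) herm_commute[of f e] by simp
  moreover have "d$3 = 0" using e3 by (simp add: d_def k_def)
  ultimately have "d = 0" using n[of d] by (simp add: vec3_eq_iff add_nonneg_eq_0_iff)
  then have "f = k *s e" by (simp add: d_def)
  then show ?thesis by (rule that)
qed

text \<open>Otherwise the two vectors would span a negative definite plane, but the combination
  \<open>r\<close> has third coordinate zero and so cannot be negative.\<close>

lemma negative_not_orthogonal:
  assumes "Re (herm p p) < 0" "Re (herm q q) < 0"
  shows "herm p q \<noteq> 0"
proof
  assume o: "herm p q = 0"
  define r where "r = q$3 *s p - p$3 *s q"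
  have "herm r r = complex_of_real ((cmod (q$3))\<^sup>2) * herm p p + complex_of_real ((cmod (p$3))\<^sup>2) * herm q q
      - q$3 * cnj (p$3) * herm p q - p$3 * cnj (q$3) * cnj (herm p q)"
    unfolding complex_norm_square
    by (simp add: r_def herm_def algebra_simps)
  then have rr: "Re (herm r r) = (cmod (q$3))\<^sup>2 * Re (herm p p) + (cmod (p$3))\<^sup>2 * Re (herm q q)"
    by (simp add: o del: of_real_power)
  have "r$3 = 0" by (simp add: r_def)
  then have "Re (herm r r) \<ge> 0" by (simp add: herm_self del: of_real_add of_real_diff of_real_power)
  moreover have "p$3 \<noteq> 0"
    using assms(1) by (auto simp: herm_self simp del: of_real_add of_real_diff of_real_power)
      (smt (verit) zero_le_power2)
  then have "(cmod (p$3))\<^sup>2 * Re (herm q q) < 0" using assms(2) by (simp add: mult_pos_neg)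
  moreover have "(cmod (q$3))\<^sup>2 * Re (herm p p) \<le> 0" using assms(1) by (simp add: mult_nonneg_nonpos)
  ultimately show False using rr by linarith
qed

lemma eigenvector_exists:
  assumes "det (z - mat k) = 0"
  obtains e :: "complex^3" where "e \<noteq> 0" "z *v e = k *s e"
proof -
  have "\<not> (\<exists>B. B ** (z - mat k) = mat 1)"
    using assms invertible_det_nz[of "z - mat k"] invertible_left_inverse by metis
  then obtain e where e: "(z - mat k) *v e = 0" "e \<noteq> 0"
    unfolding matrix_left_invertible_ker by metis
  have "(z - mat k) *v e = z *v e - k *s e"
    by (cases z rule: mat3E) (simp add: vec3_eq_iff mat3_mult_vec mat3_simps algebra_simps)
  then show ?thesis using e that by simp
qed

section \<open>Subalgebras containing a hyperbolic element\<close>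

text \<open>Since \<open>cnj (m + r)\<close> equals \<open>2 * Re m + r - m\<close>, the real
  subspace \<open>V\<close> is also stable under this conjugate. The product of the factor with its
  conjugate is a positive real, which can be divided out.\<close>

lemma complex_subspace_cancel:
  fixes V :: "complex set"
  assumes V: "subspace V" "\<And>x. x \<in> V \<Longrightarrow> m * x \<in> V"
    and mem: "(m + of_real r) * \<beta> \<in> V" and nz: "m + of_real r \<noteq> 0"
  shows "\<beta> \<in> V"
proof -
  let ?k = "m + of_real r"
  have "(2 * Re m + r) *\<^sub>R (?k * \<beta>) - m * (?k * \<beta>) \<in> V"
    by (intro subspace_diff[OF V(1)] subspace_scale[OF V(1)] V(2) mem)
  also have "(2 * Re m + r) *\<^sub>R (?k * \<beta>) - m * (?k * \<beta>) = (cmod ?k)\<^sup>2 *\<^sub>R \<beta>"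
  proof -
    have "complex_of_real (2 * Re m + r) - m = cnj ?k" by (simp add: complex_eq_iff)
    then have "(2 * Re m + r) *\<^sub>R (?k * \<beta>) - m * (?k * \<beta>) = cnj ?k * ?k * \<beta>"
      unfolding scaleR_conv_of_real by (simp only: mult.assoc left_diff_distrib[symmetric])
    also have "\<dots> = (cmod ?k)\<^sup>2 *\<^sub>R \<beta>"
      unfolding scaleR_conv_of_real complex_norm_square by (simp only: mult.commute)
    finally show ?thesis .
  qed
  finally show ?thesis using nz by (simp add: subspace_scaleR_iff[OF V(1)])
qed

text \<open>With \<open>k\<close> not real, \<open>b\<close> and \<open>k * b\<close> form a real
  basis of the plane.\<close>

lemma complex_subspace_full:
  fixes V :: "complex set"
  assumes V: "subspace V" and b: "b \<in> V" "b \<noteq> 0" and k: "k * b \<in> V" "Im k \<noteq> 0"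
  shows "V = UNIV"
proof (rule sym, rule UNIV_eq_I)
  fix z
  define q where "q = Im (z / b) / Im k"
  define p where "p = Re (z / b) - q * Re k"
  have "z / b = p + q * k" using k(2) by (simp add: complex_eq_iff p_def q_def)
  then have "z = p *\<^sub>R b + q *\<^sub>R (k * b)"
    using b(2) by (simp add: field_simps scaleR_conv_of_real)
  then show "z \<in> V" using V b(1) k(1) by (simp add: subspace_add subspace_scale)
qed

text \<open>Brackets of upper triangular elements have zero diagonal, brackets of those have only
  the corner entry \<open>s\<close>, and the corner entries commute.\<close>

lemma lie_solvable_upper:
  assumes "\<And>x. x \<in> w \<Longrightarrow> \<exists>c b s. x = mk c b 0 s 0"
  shows "lie_solvable w"
proof -
  \<comment> \<open>One closure fact serves both terms of the chain: \<open>P\<close> and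
    \<open>Q\<close> are each instantiated to being zero or to no restriction.\<close>
  have sub: "subspace {mk c b 0 s 0 |c b s. P c \<and> Q b}"
    if "\<And>c d k. P c \<Longrightarrow> P d \<Longrightarrow> P (c + d) \<and> P (complex_of_real k * c)" "P 0"
      "\<And>c d k. Q c \<Longrightarrow> Q d \<Longrightarrow> Q (c + d) \<and> Q (complex_of_real k * c)" "Q 0" for P Q
    unfolding subspace_def
  proof (intro conjI ballI allI)
    show "0 \<in> {mk c b 0 s 0 |c b s. P c \<and> Q b}" using that mk_zero by blast
    fix x y k assume "x \<in> {mk c b 0 s 0 |c b s. P c \<and> Q b}"
    then obtain c b s where x: "x = mk c b 0 s 0" "P c" "Q b" by blast
    have "k *\<^sub>R x = mk (k * c) (k * b) 0 (k * s) 0" by (simp add: x mk_scaleR)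
    then show "k *\<^sub>R x \<in> {mk c b 0 s 0 |c b s. P c \<and> Q b}" using that x by blast
    assume "y \<in> {mk c b 0 s 0 |c b s. P c \<and> Q b}"
    then obtain c' b' s' where y: "y = mk c' b' 0 s' 0" "P c'" "Q b'" by blast
    have "x + y = mk (c + c') (b + b') 0 (s + s') 0" by (simp add: x y mk_add)
    then show "x + y \<in> {mk c b 0 s 0 |c b s. P c \<and> Q b}" using that x y by blast
  qed
  let ?S2 = "{mk c b 0 s 0 |c b s. c = 0 \<and> b = 0}"
  let ?S1 = "{mk c b 0 s 0 |c b s. c = 0 \<and> True}"
  have "lie_solvable ?S2"
    by (rule lie_solvable_abelian) (auto simp: mk_bracket mk_zero)
  then have "lie_solvable ?S1"
    by (rule lie_solvable_step) (rule sub, simp_all, auto simp: mk_bracket mk_eq_iff)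
  then show ?thesis
  proof (rule lie_solvable_step)
    show "subspace ?S1" by (rule sub) simp_all
    fix x y assume "x \<in> w" "y \<in> w"
    then obtain c b s c' b' s' where "x = mk c b 0 s 0" "y = mk c' b' 0 s' 0" using assms by metis
    then show "bracket x y \<in> ?S1" by (auto simp: mk_bracket mk_eq_iff)
  qed
qed

text \<open>
  Here \<^term>\<open>mk l 0 0 0 0\<close> is a diagonal element with eigenvalues off the imaginary axis. Its
  adjoint action grades the algebra: \<^term>\<open>upper\<close> and \<^term>\<open>lower\<close> are the simple root spaces.
\<close>

locale hyperbolic_subalgebra =
  fixes w :: "(complex^3^3) set" and l :: complex
  assumes in_su: "w \<subseteq> su_form J21" and sub: "subspace w"
    and cl: "\<And>x y. x \<in> w \<Longrightarrow> y \<in> w \<Longrightarrow> bracket x y \<in> w"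
    and l: "mk l 0 0 0 0 \<in> w" "Re l \<noteq> 0"
begin

definition "upper = {b. mk 0 b 0 0 0 \<in> w}"
definition "lower = {g. mk 0 0 g 0 0 \<in> w}"

lemma subspace_upper: "subspace upper"
  using sub subspace_add[OF sub, of "mk 0 b 0 0 0" "mk 0 c 0 0 0" for b c]
    subspace_scale[OF sub, of "mk 0 b 0 0 0" for b]
  by (auto simp: subspace_def upper_def mk_zero mk_add mk_scaleR scaleR_conv_of_real[where 'a = complex])

lemma subspace_lower: "subspace lower"
  using sub subspace_add[OF sub, of "mk 0 0 b 0 0" "mk 0 0 c 0 0" for b c]
    subspace_scale[OF sub, of "mk 0 0 b 0 0" for b]
  by (auto simp: subspace_def lower_def mk_zero mk_add mk_scaleR scaleR_conv_of_real[where 'a = complex])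

text \<open>The root on \<open>upper\<close>. Its real part is \<open>Re l\<close>, hence nonzero;
  its imaginary part is \<open>3 * Im l\<close>, so it need not act as a real scalar.\<close>

definition "\<mu> = 2 * l - cnj l"

lemma ad_l:
  assumes "mk c b g s t \<in> w"
  shows "mk 0 (\<mu> * b) (- \<mu> * g) (2 * Re l * s) (- 2 * Re l * t) \<in> w"
  using cl[OF l(1) assms] by (simp add: mk_bracket \<mu>_def left_diff_distrib)

lemma upper_mult: "b \<in> upper \<Longrightarrow> \<mu> * b \<in> upper"
  using ad_l[of 0 b 0 0 0] by (simp add: upper_def)

lemma lower_mult: "g \<in> lower \<Longrightarrow> \<mu> * g \<in> lower"
  using subspace_neg[OF subspace_lower, of "- \<mu> * g"] ad_l[of 0 0 g 0 0] by (simp add: lower_def)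

lemma \<mu>_shift_nonzero: "\<mu> \<noteq> 0" "\<mu> + complex_of_real (2 * Re l) \<noteq> 0"
    "\<mu> + complex_of_real (- 2 * Re l) \<noteq> 0"
  using l(2) by (auto simp: complex_eq_iff \<mu>_def)

lemma root_polynomial_cancel:
  assumes "subspace V" "\<And>x. x \<in> V \<Longrightarrow> \<mu> * x \<in> V"
    and "\<mu> * (\<mu> + complex_of_real (2 * Re l)) * (\<mu> + complex_of_real (- 2 * Re l)) * \<mu> * \<beta> \<in> V"
  shows "\<beta> \<in> V"
proof -
  have c: "\<beta> \<in> V" if "(\<mu> + complex_of_real r) * \<beta> \<in> V" "\<mu> + complex_of_real r \<noteq> 0" for \<beta> r
    using assms(1,2) that by (rule complex_subspace_cancel)
  have "(\<mu> + complex_of_real (2 * Re l)) * ((\<mu> + complex_of_real (- 2 * Re l)) * (\<mu> * \<beta>)) \<in> V"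
    using c[of 0] assms(3) \<mu>_shift_nonzero by (simp add: mult.assoc)
  then have "(\<mu> + complex_of_real (- 2 * Re l)) * (\<mu> * \<beta>) \<in> V" by (rule c[OF _ \<mu>_shift_nonzero(2)])
  then have "\<mu> * \<beta> \<in> V" by (rule c[OF _ \<mu>_shift_nonzero(3)])
  then show ?thesis using c[of 0] \<mu>_shift_nonzero(1) by simp
qed

text \<open>The adjoint map of the diagonal element has eigenvalues \<mu>, -\<mu>,
  \<open>2 * Re l\<close>, \<open>- 2 * Re l\<close> and 0 on the five parts. As \<open>w\<close> is
  only a real subspace, the parts are separated by polynomials with real coefficients.\<close>

lemma components:
  assumes y: "mk c b g s t \<in> w"
  shows "b \<in> upper" "g \<in> lower" "mk 0 0 0 s 0 \<in> w" "mk 0 0 0 0 t \<in> w" "mk c 0 0 0 0 \<in> w"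
proof -
  let ?a = "Re l"
  define \<nu> where "\<nu> = \<mu> * (\<mu> + complex_of_real (2 * ?a)) * (\<mu> + complex_of_real (- 2 * ?a))"
  note y1 = ad_l[OF y]
  note y3 = ad_l[OF ad_l[OF y1]]
  have nu: "\<nu> = \<mu> * \<mu> * \<mu> - 4 * ?a * ?a * \<mu>" by (simp add: \<nu>_def algebra_simps)
  \<comment> \<open>The third power minus \<open>4 * ?a * ?a\<close> times the first power vanishes
    at the two real eigenvalues, so \<open>s\<close> and \<open>t\<close> disappear.\<close>
  have z: "mk 0 (\<nu> * b) (- \<nu> * g) 0 0 \<in> w"
    using subspace_diff[OF sub y3 subspace_scale[OF sub y1, of "4 * ?a * ?a"]]
    unfolding mk_scaleR mk_diff by (simp add: nu algebra_simps)
  note z1 = ad_l[OF z]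
  note z2 = ad_l[OF z1]
  \<comment> \<open>\<mu> is a root of a real quadratic with middle coefficient
    \<open>- 2 * ?a\<close>. The quadratic with the opposite middle coefficient has root -\<mu> and
    takes the value \<open>4 * ?a * \<mu>\<close> at \<mu>: it removes \<open>g\<close> and keeps
    \<open>b\<close>. Exchanging the two quadratics isolates \<open>g\<close>.\<close>
  have sq: "\<mu> * \<mu> + (cmod \<mu>)\<^sup>2 = 2 * ?a * \<mu>"
    unfolding complex_norm_square \<mu>_def by (simp add: complex_eq_iff algebra_simps)
  have "mk 0 (4 * ?a * \<mu> * \<nu> * b) 0 0 0 \<in> w"
  proof -
    have "mk 0 (\<mu> * (\<mu> * (\<nu> * b)) + (cmod \<mu>)\<^sup>2 * (\<nu> * b) + 2 * ?a * (\<mu> * (\<nu> * b)))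
        (- \<mu> * (- \<mu> * (- \<nu> * g)) + (cmod \<mu>)\<^sup>2 * (- \<nu> * g) + 2 * ?a * (- \<mu> * (- \<nu> * g))) 0 0 \<in> w"
      using subspace_add[OF sub subspace_add[OF sub z2 subspace_scale[OF sub z, of "(cmod \<mu>)\<^sup>2"]]
          subspace_scale[OF sub z1, of "2 * ?a"]]
      unfolding mk_scaleR mk_add by (simp add: mult.assoc)
    also have "\<mu> * (\<mu> * (\<nu> * b)) + (cmod \<mu>)\<^sup>2 * (\<nu> * b) + 2 * ?a * (\<mu> * (\<nu> * b))
        = (\<mu> * \<mu> + (cmod \<mu>)\<^sup>2 + 2 * ?a * \<mu>) * (\<nu> * b)" by (simp add: algebra_simps)
    also have "- \<mu> * (- \<mu> * (- \<nu> * g)) + (cmod \<mu>)\<^sup>2 * (- \<nu> * g) + 2 * ?a * (- \<mu> * (- \<nu> * g))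
        = (2 * ?a * \<mu> - (\<mu> * \<mu> + (cmod \<mu>)\<^sup>2)) * (\<nu> * g)" by (simp add: algebra_simps)
    finally show ?thesis unfolding sq by (simp add: mult_ac)
  qed
  then have "(4 * ?a) *\<^sub>R (\<mu> * \<nu> * b) \<in> upper"
    by (simp add: upper_def scaleR_conv_of_real[where 'a = complex] mult_ac)
  then have "\<mu> * \<nu> * b \<in> upper"
    by (rule subspace_scaleR_cancel[OF subspace_upper]) (simp add: l(2))
  then show b: "b \<in> upper"
    by - (rule root_polynomial_cancel[OF subspace_upper], rule upper_mult, assumption, simp add: \<nu>_def mult_ac)
  have "mk 0 0 (4 * ?a * \<mu> * \<nu> * g) 0 0 \<in> w"
  proof -
    have "mk 0 (2 * ?a * (\<mu> * (\<nu> * b)) - (\<mu> * (\<mu> * (\<nu> * b)) + (cmod \<mu>)\<^sup>2 * (\<nu> * b)))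
        (2 * ?a * (- \<mu> * (- \<nu> * g)) - (- \<mu> * (- \<mu> * (- \<nu> * g)) + (cmod \<mu>)\<^sup>2 * (- \<nu> * g))) 0 0 \<in> w"
      using subspace_diff[OF sub subspace_scale[OF sub z1, of "2 * ?a"]
          subspace_add[OF sub z2 subspace_scale[OF sub z, of "(cmod \<mu>)\<^sup>2"]]]
      unfolding mk_scaleR mk_add mk_diff by (simp add: mult.assoc)
    also have "2 * ?a * (\<mu> * (\<nu> * b)) - (\<mu> * (\<mu> * (\<nu> * b)) + (cmod \<mu>)\<^sup>2 * (\<nu> * b))
        = (2 * ?a * \<mu> - (\<mu> * \<mu> + (cmod \<mu>)\<^sup>2)) * (\<nu> * b)" by (simp add: algebra_simps)
    also have "2 * ?a * (- \<mu> * (- \<nu> * g)) - (- \<mu> * (- \<mu> * (- \<nu> * g)) + (cmod \<mu>)\<^sup>2 * (- \<nu> * g))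
        = (2 * ?a * \<mu> + (\<mu> * \<mu> + (cmod \<mu>)\<^sup>2)) * (\<nu> * g)" by (simp add: algebra_simps)
    finally show ?thesis unfolding sq by (simp add: mult_ac)
  qed
  then have "(4 * ?a) *\<^sub>R (\<mu> * \<nu> * g) \<in> lower"
    by (simp add: lower_def scaleR_conv_of_real[where 'a = complex] mult_ac)
  then have "\<mu> * \<nu> * g \<in> lower"
    by (rule subspace_scaleR_cancel[OF subspace_lower]) (simp add: l(2))
  then show g: "g \<in> lower"
    by - (rule root_polynomial_cancel[OF subspace_lower], rule lower_mult, assumption, simp add: \<nu>_def mult_ac)
  have y': "mk c 0 0 s t \<in> w"
    using subspace_diff[OF sub subspace_diff[OF sub y, of "mk 0 b 0 0 0"], of "mk 0 0 g 0 0"] b g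
    by (simp add: upper_def lower_def mk_diff)
  have y1': "mk 0 0 0 (2 * ?a * s) (- 2 * ?a * t) \<in> w" using ad_l[OF y'] by simp
  have y2': "mk 0 0 0 (4 * ?a * ?a * s) (4 * ?a * ?a * t) \<in> w"
    using ad_l[OF y1'] by (simp add: mult_ac)
  have "(8 * ?a * ?a) *\<^sub>R mk 0 0 0 s 0 \<in> w"
    using subspace_add[OF sub y2' subspace_scale[OF sub y1', of "2 * ?a"]]
    by (simp add: mk_add mk_scaleR mult_ac)
  then show s: "mk 0 0 0 s 0 \<in> w"
    by (rule subspace_scaleR_cancel[OF sub]) (simp add: l(2))
  have "(8 * ?a * ?a) *\<^sub>R mk 0 0 0 0 t \<in> w"
    using subspace_diff[OF sub y2' subspace_scale[OF sub y1', of "2 * ?a"]]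
    by (simp add: mk_diff mk_scaleR mult_ac)
  then show t: "mk 0 0 0 0 t \<in> w"
    by (rule subspace_scaleR_cancel[OF sub]) (simp add: l(2))
  show "mk c 0 0 0 0 \<in> w"
    using subspace_diff[OF sub subspace_diff[OF sub y' s] t] by (simp add: mk_diff)
qed

end

text \<open>Conjugation by \<open>J21\<close> reverses the order of the basis and exchanges lower
  with upper triangular matrices.\<close>

lemma lie_solvable_lower:
  assumes "\<And>x. x \<in> w \<Longrightarrow> \<exists>c g t. x = mk c 0 g 0 t"
  shows "lie_solvable w"
proof -
  define f where "f X = J21 ** X ** J21" for X
  have J2: "J21 ** J21 = mat 1" by (simp add: J21_def mat3_simps)
  have lin: "linear f"
    by (rule linearI) (simp_all add: f_def matrix_linear_simps)
  have br: "f (bracket x y) = bracket (f x) (f y)" for x y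
  proof -
    have "J21 ** x ** J21 ** (J21 ** y ** J21) = J21 ** (x ** y) ** J21" for x y
    proof -
      have "J21 ** x ** J21 ** (J21 ** y ** J21) = J21 ** x ** (J21 ** J21) ** y ** J21"
        by (simp only: matrix_mul_assoc)
      then show ?thesis by (simp add: J2 matrix_mul_assoc)
    qed
    then show ?thesis by (simp add: f_def bracket_def matrix_linear_simps)
  qed
  have ff: "f (f x) = x" for x
  proof -
    have "f (f x) = (J21 ** J21) ** x ** (J21 ** J21)" by (simp only: f_def matrix_mul_assoc)
    then show ?thesis by (simp add: J2)
  qed
  have fmk: "f (mk c b g s t) = mk (- cnj c) (- cnj g) (- cnj b) t s" for c b g s t
    by (simp add: f_def J21_def mk_def mat3_simps)
  have "lie_solvable (f ` w)"
  proof (rule lie_solvable_upper)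
    fix x assume "x \<in> f ` w"
    then obtain y where "y \<in> w" "x = f y" by auto
    then obtain c g t where "x = f (mk c 0 g 0 t)" using assms by metis
    then show "\<exists>c b s. x = mk c b 0 s 0" by (auto simp: fmk)
  qed
  then have "lie_solvable (f ` f ` w)" by (rule lie_solvable_image[OF lin br])
  then show ?thesis by (simp add: image_image ff)
qed

context hyperbolic_subalgebra
begin

lemma mk_repr:
  assumes "x \<in> w"
  obtains c b g s t where "x = mk c b g s t" "mk c b g s t \<in> w"
proof -
  obtain c b g s t where "x = mk c b g s t" using su_form_J21E subsetD[OF in_su assms] by metis
  then show ?thesis using that assms by simp
qed

lemma sum_components:
  assumes "mk c 0 0 0 0 \<in> w" "b \<in> upper" "g \<in> lower" "mk 0 0 0 s 0 \<in> w" "mk 0 0 0 0 t \<in> w"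
  shows "mk c b g s t \<in> w"
proof -
  have "mk c 0 0 0 0 + mk 0 b 0 0 0 + mk 0 0 g 0 0 + mk 0 0 0 s 0 + mk 0 0 0 0 t \<in> w"
    using assms by (intro subspace_add[OF sub]) (simp_all add: upper_def lower_def)
  then show ?thesis by (simp add: mk_add)
qed

lemma upper_lower: "b \<in> upper \<Longrightarrow> g \<in> lower \<Longrightarrow> mk (b * g) 0 0 0 0 \<in> w"
  using cl[of "mk 0 b 0 0 0" "mk 0 0 g 0 0"] by (simp add: upper_def lower_def mk_bracket)

lemma diagonal_upper: "mk c 0 0 0 0 \<in> w \<Longrightarrow> b \<in> upper \<Longrightarrow> (2 * c - cnj c) * b \<in> upper"
  using cl[of "mk c 0 0 0 0" "mk 0 b 0 0 0"] by (simp add: upper_def mk_bracket)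

lemma diagonal_lower: "mk c 0 0 0 0 \<in> w \<Longrightarrow> g \<in> lower \<Longrightarrow> (2 * c - cnj c) * g \<in> lower"
  using cl[of "mk 0 0 g 0 0" "mk c 0 0 0 0"] by (simp add: lower_def mk_bracket)

lemma highest_lower: "mk 0 0 0 s 0 \<in> w \<Longrightarrow> g \<in> lower \<Longrightarrow> \<i> * s * cnj g \<in> upper"
  using cl[of "mk 0 0 g 0 0" "mk 0 0 0 s 0"] by (simp add: lower_def upper_def mk_bracket)

lemma lowest_upper: "mk 0 0 0 0 t \<in> w \<Longrightarrow> b \<in> upper \<Longrightarrow> \<i> * t * cnj b \<in> lower"
  using cl[of "mk 0 0 0 0 t" "mk 0 b 0 0 0"] by (simp add: lower_def upper_def mk_bracket)

lemma zero_in: "0 \<in> upper" "0 \<in> lower"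
  using subspace_0[OF subspace_upper] subspace_0[OF subspace_lower] .

text \<open>What remains is sl(2,R), given by real \<open>c\<close>, \<open>s\<close> and
  \<open>t\<close>, together with the central element \<open>mk \<i> 0 0 0 0\<close>. The generators
  are the images of \<open>A1 + A2\<close>, \<open>A5\<close>, \<open>A6\<close> in the frame used
  for \<open>v35\<close>.\<close>

lemma no_simple_roots:
  assumes ss: "lie_semisimple w" and up: "upper = {0}" and lo: "lower = {0}"
  shows "w = span {mk 0 0 0 1 1, mk 1 0 0 0 0, mk 0 0 0 (- 1) 1}"
proof -
  have repr: "\<exists>c s t. x = mk c 0 0 s t" if "x \<in> w" for x
  proof -
    obtain c b g s t where x: "x = mk c b g s t" "mk c b g s t \<in> w" using \<open>x \<in> w\<close> by (rule mk_repr)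
    then have "b = 0" "g = 0" using components(1,2)[OF x(2)] up lo by simp_all
    then show ?thesis using x by blast
  qed
  have in_span: "mk (complex_of_real r) 0 0 s t \<in> span {mk 0 0 0 1 1, mk 1 0 0 0 0, mk 0 0 0 (- 1) 1}" for r s t
  proof -
    have "((s + t) / 2) *\<^sub>R mk 0 0 0 1 1 + r *\<^sub>R mk 1 0 0 0 0 + ((t - s) / 2) *\<^sub>R mk 0 0 0 (- 1) 1
        \<in> span {mk 0 0 0 1 1, mk 1 0 0 0 0, mk 0 0 0 (- 1) 1}"
      by (intro span_add span_scale span_base) simp_all
    moreover have "((s + t) / 2) *\<^sub>R mk 0 0 0 1 1 + r *\<^sub>R mk 1 0 0 0 0 + ((t - s) / 2) *\<^sub>R mk 0 0 0 (- 1) 1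
        = mk (complex_of_real r) 0 0 s t" by (simp add: mk_scaleR mk_add mk_eq_iff field_simps)
    ultimately show ?thesis by simp
  qed
  show ?thesis
  proof (rule semisimple_in_central_extension[OF ss sub _ cl])
    have "mk l 0 0 0 0 \<noteq> 0" using l(2) by (auto simp: mk_zero mk_eq_iff)
    then show "w \<noteq> {0}" using l(1) by auto
    fix x y assume "x \<in> w" "y \<in> w"
    then obtain c s t c' s' t' where xy: "x = mk c 0 0 s t" "y = mk c' 0 0 s' t'"
      using repr by metis
    show "bracket x y \<in> span {mk 0 0 0 1 1, mk 1 0 0 0 0, mk 0 0 0 (- 1) 1}"
      using in_span[of "s' * t - s * t'"] by (simp add: xy mk_bracket)
  next
    fix x assume "x \<in> w"
    then obtain c s t where x: "x = mk c 0 0 s t" using repr by metis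
    have "x - Im c *\<^sub>R mk \<i> 0 0 0 0 = mk (complex_of_real (Re c)) 0 0 s t"
      by (simp add: x mk_scaleR mk_diff mk_eq_iff complex_eq_iff)
    then show "\<exists>k. x - k *\<^sub>R mk \<i> 0 0 0 0 \<in> span {mk 0 0 0 1 1, mk 1 0 0 0 0, mk 0 0 0 (- 1) 1}"
      using in_span by metis
    show "bracket x (mk \<i> 0 0 0 0) = 0" by (simp add: x mk_bracket mk_zero)
  qed
qed

text \<open>A nonzero element of \<open>lower\<close> would carry the highest root space into
  \<open>upper\<close>. If \<open>upper\<close> is zero, the \<open>s\<close> entry must therefore
  vanish too, which leaves a triangular algebra; the other direction is symmetric.\<close>

lemma simple_roots_opposite:
  assumes ss: "lie_semisimple w"
  shows "upper = {0} \<longleftrightarrow> lower = {0}"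
proof -
  have ne: "w \<noteq> {0}"
  proof -
    have "mk l 0 0 0 0 \<noteq> 0" using l(2) by (auto simp: mk_zero mk_eq_iff)
    then show ?thesis using l(1) by auto
  qed
  have not_solvable: "\<not> lie_solvable w"
    using lie_semisimple_not_solvable[OF ss sub cl] ne by metis
  show ?thesis
  proof (rule iffI; rule ccontr)
    assume up: "upper = {0}" and "lower \<noteq> {0}"
    then obtain g0 where g0: "g0 \<in> lower" "g0 \<noteq> 0" using zero_in by auto
    have "\<exists>c g t. x = mk c 0 g 0 t" if "x \<in> w" for x
    proof -
      obtain c b g s t where x: "x = mk c b g s t" "mk c b g s t \<in> w" using \<open>x \<in> w\<close> by (rule mk_repr)
      have "b = 0" using components(1)[OF x(2)] up by simp
      moreover have "s = 0" using highest_lower[OF components(3)[OF x(2)] g0(1)] up g0(2) by simp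
      ultimately show ?thesis using x by blast
    qed
    then show False using not_solvable lie_solvable_lower by metis
  next
    assume lo: "lower = {0}" and "upper \<noteq> {0}"
    then obtain b0 where b0: "b0 \<in> upper" "b0 \<noteq> 0" using zero_in by auto
    have "\<exists>c b s. x = mk c b 0 s 0" if "x \<in> w" for x
    proof -
      obtain c b g s t where x: "x = mk c b g s t" "mk c b g s t \<in> w" using \<open>x \<in> w\<close> by (rule mk_repr)
      have "g = 0" using components(2)[OF x(2)] lo by simp
      moreover have "t = 0" using lowest_upper[OF components(4)[OF x(2)] b0(1)] lo b0(2) by simp
      ultimately show ?thesis using x by blast
    qed
    then show False using not_solvable lie_solvable_upper by metis
  qed
qed

text \<open>\<open>2 * c - cnj c\<close> has imaginary part \<open>3 * Im c\<close>; if that were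
  nonzero, its action would make \<open>upper\<close> the whole plane.\<close>

lemma diagonal_real_if_upper:
  assumes "upper \<noteq> UNIV" "b \<in> upper" "b \<noteq> 0" "mk c 0 0 0 0 \<in> w"
  shows "Im c = 0"
  using complex_subspace_full[OF subspace_upper assms(2,3) diagonal_upper[OF assms(4,2)]] assms(1)
  by auto

text \<open>Products with \<open>g0\<close> fill the diagonal, the diagonal element for
  \<open>\<i>\<close> multiplies \<open>lower\<close> by \<open>3 * \<i>\<close> and so fills it,
  and brackets within \<open>upper\<close> and within \<open>lower\<close> produce the two
  corners.\<close>

lemma all_if_upper:
  assumes "upper = UNIV" "g0 \<in> lower" "g0 \<noteq> 0"
  shows "w = su_form J21"
proof -
  have c: "mk c 0 0 0 0 \<in> w" for c
    using upper_lower[of "c / g0" g0] assms by simp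
  have "(2 * \<i> - cnj \<i>) * g0 \<in> lower" by (rule diagonal_lower[OF c assms(2)])
  then have lo: "lower = UNIV"
    by (rule complex_subspace_full[OF subspace_lower assms(2,3)]) simp
  have "mk 0 0 0 2 0 \<in> w"
    using cl[of "mk 0 1 0 0 0" "mk 0 \<i> 0 0 0"] assms(1) by (auto simp: upper_def mk_bracket)
  then have s: "mk 0 0 0 s 0 \<in> w" for s
    using subspace_scale[OF sub, of _ "s / 2"] by (fastforce simp: mk_scaleR)
  have "mk 0 0 0 0 2 \<in> w"
    using cl[of "mk 0 0 \<i> 0 0" "mk 0 0 1 0 0"] lo by (auto simp: lower_def mk_bracket)
  then have t: "mk 0 0 0 0 t \<in> w" for t
    using subspace_scale[OF sub, of _ "t / 2"] by (fastforce simp: mk_scaleR)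
  have "x \<in> w" if "x \<in> su_form J21" for x
  proof -
    obtain c' b g s' t' where x: "x = mk c' b g s' t'" using \<open>x \<in> su_form J21\<close> by (rule su_form_J21E)
    show ?thesis unfolding x by (rule sum_components) (simp_all add: c s t lo assms(1))
  qed
  then show ?thesis using in_su by auto
qed

lemma simple_roots:
  assumes proper: "w \<noteq> su_form J21" and up: "upper \<noteq> {0}" and lo: "lower \<noteq> {0}"
  obtains \<omega> where "\<omega> * cnj \<omega> = 1"
    "w = {mk (complex_of_real r) (complex_of_real p * \<omega>) (complex_of_real q * cnj \<omega>) 0 0 | r p q. True}"
proof -
  obtain b0 g0 where b0: "b0 \<in> upper" "b0 \<noteq> 0" and g0: "g0 \<in> lower" "g0 \<noteq> 0"
    using up lo zero_in by auto
  have up': "upper \<noteq> UNIV" using all_if_upper[OF _ g0] proper by auto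
  \<comment> \<open>A full \<open>lower\<close> would contain \<open>\<i> / b0\<close>, whose
    bracket with \<open>b0\<close> is a diagonal element with \<open>c\<close> not real.\<close>
  have lo': "lower \<noteq> UNIV"
  proof
    assume lower: "lower = UNIV"
    then have "mk (b0 * (\<i> / b0)) 0 0 0 0 \<in> w"
      by (intro upper_lower b0(1)) (simp add: lower)
    then have "mk \<i> 0 0 0 0 \<in> w" using b0(2) by simp
    then show False using diagonal_real_if_upper[OF up' b0] by fastforce
  qed
  have diag: "Im c = 0" if "mk c 0 0 0 0 \<in> w" for c
    using diagonal_real_if_upper[OF up' b0 that] .
  define \<rho> where "\<rho> = Re (b0 * g0)"
  have rho: "b0 * g0 = complex_of_real \<rho>"
    using diag[OF upper_lower[OF b0(1) g0(1)]] by (simp add: \<rho>_def complex_eq_iff)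
  have rho0: "\<rho> \<noteq> 0" using rho b0(2) g0(2) by auto
  have upr: "Im k = 0" if "k * b0 \<in> upper" for k
    using complex_subspace_full[OF subspace_upper b0 that] up' by auto
  have lor: "Im k = 0" if "k * g0 \<in> lower" for k
    using complex_subspace_full[OF subspace_lower g0 that] lo' by auto
  \<comment> \<open>As \<open>b0 * g0\<close> is real, \<open>cnj g0\<close> is a real multiple of
    \<open>b0\<close>. Hence \<open>\<i> * s * cnj g0\<close> is an imaginary multiple of
    \<open>b0\<close> and lies in \<open>upper\<close> only if \<open>s\<close> is zero. The same
    holds for \<open>t\<close> with the roles exchanged.\<close>
  have cg: "cnj g0 = complex_of_real ((cmod g0)\<^sup>2 / \<rho>) * b0"
  proof -
    have "cnj g0 * complex_of_real \<rho> = complex_of_real ((cmod g0)\<^sup>2) * b0"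
      unfolding complex_norm_square rho[symmetric] by (simp only: mult_ac)
    then show ?thesis using rho0 by (simp add: field_simps)
  qed
  have cb: "cnj b0 = complex_of_real ((cmod b0)\<^sup>2 / \<rho>) * g0"
  proof -
    have "cnj b0 * complex_of_real \<rho> = complex_of_real ((cmod b0)\<^sup>2) * g0"
      unfolding complex_norm_square rho[symmetric] by (simp only: mult_ac)
    then show ?thesis using rho0 by (simp add: field_simps)
  qed
  have s0: "s = 0" if "mk 0 0 0 s 0 \<in> w" for s
  proof -
    have "\<i> * s * complex_of_real ((cmod g0)\<^sup>2 / \<rho>) * b0 \<in> upper"
      using highest_lower[OF that g0(1)] unfolding cg by (simp only: mult.assoc)
    then show ?thesis using upr g0(2) rho0 by fastforce
  qed
  have t0: "t = 0" if "mk 0 0 0 0 t \<in> w" for t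
  proof -
    have "\<i> * t * complex_of_real ((cmod b0)\<^sup>2 / \<rho>) * g0 \<in> lower"
      using lowest_upper[OF that b0(1)] unfolding cb by (simp only: mult.assoc)
    then show ?thesis using lor b0(2) rho0 by fastforce
  qed
  \<comment> \<open>This is the phase of \<open>b0\<close>; since \<open>b0 * g0\<close> is real,
    \<open>g0\<close> has the conjugate phase up to sign.\<close>
  define \<omega> where "\<omega> = b0 / cmod b0"
  have om: "\<omega> * cnj \<omega> = 1"
    using b0(2) by (simp add: \<omega>_def complex_norm_square[symmetric] power2_eq_square[symmetric])
  have b0w: "b0 = cmod b0 * \<omega>" using b0(2) by (simp add: \<omega>_def)
  have g0w: "g0 = complex_of_real (\<rho> / cmod b0) * cnj \<omega>"
  proof -
    have "complex_of_real (cmod b0) * (\<omega> * cnj \<omega>) * g0 = cnj \<omega> * (b0 * g0)"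
      by (subst (2) b0w) (simp only: mult_ac)
    then show ?thesis using b0(2) by (simp add: om rho field_simps)
  qed
  have "w = {mk (complex_of_real r) (complex_of_real p * \<omega>) (complex_of_real q * cnj \<omega>) 0 0 | r p q. True}"
  proof (intro subset_antisym subsetI)
    fix x assume "x \<in> w"
    then obtain c b g s t where x: "x = mk c b g s t" "mk c b g s t \<in> w" by (rule mk_repr)
    note comp = components[OF x(2)]
    have "c = complex_of_real (Re c)" using diag[OF comp(5)] by (simp add: complex_eq_iff)
    moreover have "b = complex_of_real (Re (b / b0) * cmod b0) * \<omega>"
    proof -
      have "Im (b / b0) = 0" using upr[of "b / b0"] comp(1) b0(2) by simp
      then have "b / b0 = complex_of_real (Re (b / b0))" by (simp add: complex_eq_iff)
      then have "b / b0 * b0 = complex_of_real (Re (b / b0)) * b0" by (rule arg_cong)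
      then have "b = complex_of_real (Re (b / b0)) * b0" using b0(2) by simp
      also have "\<dots> = complex_of_real (Re (b / b0)) * (cmod b0 * \<omega>)" using b0w by (rule arg_cong)
      finally show ?thesis unfolding of_real_mult mult.assoc .
    qed
    moreover have "g = complex_of_real (Re (g / g0) * (\<rho> / cmod b0)) * cnj \<omega>"
    proof -
      have "Im (g / g0) = 0" using lor[of "g / g0"] comp(2) g0(2) by simp
      then have "g / g0 = complex_of_real (Re (g / g0))" by (simp add: complex_eq_iff)
      then have "g / g0 * g0 = complex_of_real (Re (g / g0)) * g0" by (rule arg_cong)
      then have "g = complex_of_real (Re (g / g0)) * g0" using g0(2) by simp
      also have "\<dots> = complex_of_real (Re (g / g0)) * (complex_of_real (\<rho> / cmod b0) * cnj \<omega>)"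
        using g0w by (rule arg_cong)
      finally show ?thesis unfolding of_real_mult mult.assoc .
    qed
    ultimately have "x = mk (complex_of_real (Re c)) (complex_of_real (Re (b / b0) * cmod b0) * \<omega>)
        (complex_of_real (Re (g / g0) * (\<rho> / cmod b0)) * cnj \<omega>) 0 0"
      unfolding x(1) mk_eq_iff using s0[OF comp(3)] t0[OF comp(4)] by (intro conjI)
    then show "x \<in> {mk (complex_of_real r) (complex_of_real p * \<omega>) (complex_of_real q * cnj \<omega>) 0 0 | r p q. True}" by blast
  next
    fix x assume "x \<in> {mk (complex_of_real r) (complex_of_real p * \<omega>) (complex_of_real q * cnj \<omega>) 0 0 | r p q. True}"
    then obtain r p q :: real where x: "x = mk r (p * \<omega>) (q * cnj \<omega>) 0 0" by blast
    have "(r / \<rho>) *\<^sub>R mk (b0 * g0) 0 0 0 0 \<in> w"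
      by (intro subspace_scale[OF sub] upper_lower b0(1) g0(1))
    then have "mk r 0 0 0 0 \<in> w" using rho0 by (simp add: mk_scaleR rho)
    moreover have "(p / cmod b0) *\<^sub>R b0 \<in> upper" by (rule subspace_scale[OF subspace_upper b0(1)])
    then have "p * \<omega> \<in> upper" by (simp add: \<omega>_def scaleR_conv_of_real[where 'a = complex])
    moreover have "(q * cmod b0 / \<rho>) *\<^sub>R g0 \<in> lower" by (rule subspace_scale[OF subspace_lower g0(1)])
    then have "q * cnj \<omega> \<in> lower"
      by (subst (asm) g0w) (use rho0 b0(2) in \<open>simp add: scaleR_conv_of_real[where 'a = complex]\<close>)
    moreover have "mk 0 0 0 0 0 \<in> w" using subspace_0[OF sub] by (simp add: mk_zero)
    ultimately show "x \<in> w" unfolding x by - (rule sum_components)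
  qed
  then show ?thesis by (rule that[OF om])
qed

end

section \<open>Subalgebras with negative semidefinite trace form\<close>

lemma trace_bracket_assoc: "trace (bracket x y ** z) = trace (x ** bracket y z)"
  for x y z :: "complex^3^3"
  by (cases x rule: mat3E, cases y rule: mat3E, cases z rule: mat3E)
    (simp add: bracket_def mat3_simps algebra_simps)

lemma trace_add: "trace (x + y) = trace x + trace y" for x y :: "complex^3^3"
  by (simp add: trace_def sum_3)

lemma trace_scaleR: "trace (k *\<^sub>R x) = k * trace x" for x :: "complex^3^3"
  by (simp add: trace_def sum_3 scaleR_conv_of_real[where 'a = complex] algebra_simps)

text \<open>For a semidefinite form, a null vector is orthogonal to everything: otherwise the form
  at \<open>y + t *\<^sub>R z\<close> would be affine in \<open>t\<close> with nonzero
  slope.\<close>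

lemma trace_form_radical:
  fixes z :: "complex^3^3"
  assumes sub: "subspace w" and neg: "\<And>x. x \<in> w \<Longrightarrow> Re (trace (x ** x)) \<le> 0"
    and z: "z \<in> w" "Re (trace (z ** z)) = 0" and y: "y \<in> w"
  shows "Re (trace (z ** y)) = 0"
proof (rule ccontr)
  assume B: "Re (trace (z ** y)) \<noteq> 0"
  \<comment> \<open>Chosen so that the form takes the value 1 at
    \<open>y + t *\<^sub>R z\<close>.\<close>
  define t where "t = (1 - Re (trace (y ** y))) / (2 * Re (trace (z ** y)))"
  have "y + t *\<^sub>R z \<in> w" using sub y z(1) by (simp add: subspace_add subspace_scale)
  then have "Re (trace ((y + t *\<^sub>R z) ** (y + t *\<^sub>R z))) \<le> 0" by (rule neg)
  moreover have "Re (trace ((y + t *\<^sub>R z) ** (y + t *\<^sub>R z)))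
      = Re (trace (y ** y)) + 2 * t * Re (trace (z ** y)) + t\<^sup>2 * Re (trace (z ** z))"
    using trace_mult_commute[of y z]
    by (simp add: matrix_linear_simps trace_add trace_scaleR power2_eq_square algebra_simps)
  moreover have "2 * t * Re (trace (z ** y)) = 1 - Re (trace (y ** y))"
    using B by (simp add: t_def)
  ultimately show False using z(2) by simp
qed

text \<open>
  The radical of the trace form is an ideal on which the form vanishes; bracketing a nilpotent
  element with an arbitrary \<^term>\<open>y\<close> therefore forces the lower triangular entries of \<^term>\<open>y\<close> to be zero.
\<close>

lemma lie_solvable_if_highest_root:
  assumes in_su: "w \<subseteq> su_form J21" and sub: "subspace w"
    and cl: "\<And>x y. x \<in> w \<Longrightarrow> y \<in> w \<Longrightarrow> bracket x y \<in> w"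
    and neg: "\<And>x. x \<in> w \<Longrightarrow> Re (trace (x ** x)) \<le> 0"
    and z: "mk 0 0 0 s 0 \<in> w" "s \<noteq> 0"
  shows "lie_solvable w"
proof (rule lie_solvable_upper)
  fix y assume y: "y \<in> w"
  obtain c b g s' t where yc: "y = mk c b g s' t" using subsetD[OF in_su y] by (rule su_form_J21E)
  have "Re (trace (mk 0 0 0 s 0 ** y)) = 0"
    by (rule trace_form_radical[OF sub neg z(1) _ y]) (simp_all add: trace_mk_mult)
  then have t: "t = 0" using z(2) by (simp add: yc trace_mk_mult)
  define y1 where "y1 = bracket (mk 0 0 0 s 0) y"
  define y2 where "y2 = bracket y1 y"
  have in_w: "y1 \<in> w" "y2 \<in> w" unfolding y2_def y1_def by (intro cl z(1) y)+
  have y1: "y1 = mk 0 (- \<i> * s * cnj g) 0 (- 2 * Re c * s) 0"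
    by (simp add: y1_def yc t mk_bracket)
  obtain b2 s2 where y2: "y2 = mk (- \<i> * s * (cmod g)\<^sup>2) b2 0 s2 0"
  proof
    show "y2 = mk (- \<i> * s * (cmod g)\<^sup>2) (- (2 * c - cnj c) * (- \<i> * s * cnj g)  - \<i> * (- 2 * Re c * s) * cnj g)
      0 (- 2 * Re c * (- 2 * Re c * s) + 2 * Im (b * cnj (- \<i> * s * cnj g))) 0"
      unfolding complex_norm_square y2_def y1 yc t mk_bracket mk_eq_iff
      by (simp add: algebra_simps)
  qed
  \<comment> \<open>\<open>y1\<close> is strictly upper triangular, hence in the radical; by
    invariance the form also vanishes on \<open>y2\<close>. The diagonal of \<open>y2\<close> is
    imaginary and proportional to the squared modulus of \<open>g\<close>, so its square has
    negative trace unless \<open>g\<close> is zero.\<close>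
  have "Re (trace (y1 ** bracket y y2)) = 0"
    by (rule trace_form_radical[OF sub neg in_w(1) _ cl[OF y in_w(2)]]) (simp_all add: y1 trace_mk_mult)
  then have "Re (trace (y2 ** y2)) = 0" unfolding trace_bracket_assoc[symmetric] y2_def[symmetric] .
  then have "g = 0" using z(2) by (simp add: y2 trace_mk_square)
  then show "\<exists>c b s. y = mk c b 0 s 0" using yc t by blast
qed

text \<open>If some element has a lowest entry \<open>t\<close>, repeated brackets with the
  nilpotent element move it up to the highest root. If none has, orthogonality to the radical
  removes the entries \<open>g\<close>.\<close>

lemma lie_solvable_if_upper_nilpotent:
  assumes in_su: "w \<subseteq> su_form J21" and sub: "subspace w"
    and cl: "\<And>x y. x \<in> w \<Longrightarrow> y \<in> w \<Longrightarrow> bracket x y \<in> w"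
    and neg: "\<And>x. x \<in> w \<Longrightarrow> Re (trace (x ** x)) \<le> 0"
    and z: "mk 0 b 0 s 0 \<in> w" "mk 0 b 0 s 0 \<noteq> 0"
  shows "lie_solvable w"
proof (cases "b = 0")
  case True
  then show ?thesis
    using lie_solvable_if_highest_root[OF in_su sub cl neg, of s] z by (simp add: mk_zero mk_eq_iff)
next
  case b: False
  let ?z = "mk 0 b 0 s 0"
  show ?thesis
  proof (cases "\<forall>y\<in>w. \<exists>c b g s. y = mk c b g s 0")
    case False
    then obtain y where y: "y \<in> w" "\<nexists>c b g s. y = mk c b g s 0" by blast
    obtain c' b' g' s' t where yc: "y = mk c' b' g' s' t" using subsetD[OF in_su y(1)] by (rule su_form_J21E)
    then have t: "t \<noteq> 0" using y(2) by blast
    \<comment> \<open>Four brackets raise the degree from -2 to 2; the result is purely of highest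
      root type, with coefficient 6 times \<open>t\<close> times the fourth power of the modulus of
      \<open>b\<close>.\<close>
    have "bracket ?z (bracket ?z (bracket ?z (bracket ?z y))) \<in> w"
      by (intro cl z(1) y(1))
    moreover have "bracket ?z (bracket ?z (bracket ?z (bracket ?z y)))
        = mk 0 0 0 (6 * t * ((Re b)\<^sup>2 + (Im b)\<^sup>2)\<^sup>2) 0"
    proof -
      obtain c1 b1 s1 where 1: "bracket ?z y = mk c1 b1 (- \<i> * t * cnj b) s1 0"
        by (simp add: yc mk_bracket)
      obtain b2 s2 where 2: "bracket ?z (bracket ?z y) = mk (- \<i> * t * (b * cnj b)) b2 0 s2 0"
        by (simp add: 1 mk_bracket algebra_simps)
      obtain s3 where 3: "bracket ?z (bracket ?z (bracket ?z y)) = mk 0 (3 * \<i> * t * (b * cnj b) * b) 0 s3 0"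
        by (simp add: 2 mk_bracket algebra_simps)
      show ?thesis
        by (simp add: 3 mk_bracket mk_eq_iff power2_eq_square algebra_simps)
    qed
    moreover have "6 * t * ((Re b)\<^sup>2 + (Im b)\<^sup>2)\<^sup>2 \<noteq> 0"
      using t b by (auto simp: complex_eq_iff sum_power2_eq_zero_iff)
    ultimately show ?thesis using lie_solvable_if_highest_root[OF in_su sub cl neg] by metis
  next
    case True
    show ?thesis
    proof (rule lie_solvable_upper)
      fix y assume y: "y \<in> w"
      then obtain c' b' g s' where yc: "y = mk c' b' g s' 0" using True by blast
      have rad: "Re (trace (?z ** x)) = 0" if "x \<in> w" for x
        by (rule trace_form_radical[OF sub neg z(1) _ that]) (simp_all add: trace_mk_mult)
      have re: "Re (b * g) = 0" using rad[OF y] by (simp add: yc trace_mk_mult)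
      define y1 where "y1 = bracket ?z y"
      have "y1 \<in> w" unfolding y1_def by (intro cl z(1) y)
      obtain b1 s1 where y1: "y1 = mk (b * g) b1 0 s1 0" by (simp add: y1_def yc mk_bracket)
      have "Re (trace (?z ** bracket y y1)) = 0" by (rule rad) (intro cl y \<open>y1 \<in> w\<close>)
      then have "Re (trace (y1 ** y1)) = 0" unfolding trace_bracket_assoc[symmetric] y1_def[symmetric] .
      then have "- 6 * (Im (b * g))\<^sup>2 = 0" using re unfolding y1 trace_mk_square Re_complex_of_real
        by (simp del: times_complex.sel)
      then have "b * g = 0" using re by (simp add: complex_eq_iff del: times_complex.sel)
      then show "\<exists>c b s. y = mk c b 0 s 0" using yc b by auto
    qed
  qed
qed

text \<open>An element whose only entries are the noncompact \<open>u\<close> and \<open>v\<close>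
  has positive trace of its square unless it is zero. It remains to isolate these entries inside
  \<open>w\<close>.\<close>

lemma in_u2_if_regular_elliptic:
  assumes in_su: "w \<subseteq> su_form N21" and sub: "subspace w"
    and cl: "\<And>x y. x \<in> w \<Longrightarrow> y \<in> w \<Longrightarrow> bracket x y \<in> w"
    and neg: "\<And>x. x \<in> w \<Longrightarrow> Re (trace (x ** x)) \<le> 0"
    and z: "nk 1 (- 1) 0 0 0 \<in> w \<or> nk 0 1 0 0 0 \<in> w"
    and y: "y \<in> w"
  shows "\<exists>a b p. y = nk a b p 0 0"
proof -
  obtain a b p u v where yc: "y = nk a b p u v" using subsetD[OF in_su y] by (rule su_form_N21E)
  have neg_nk: "u = 0 \<and> v = 0" if "nk 0 0 0 u v \<in> w" for u v
  proof -
    have "2 * (cmod u)\<^sup>2 + 2 * (cmod v)\<^sup>2 \<le> 0" using neg[OF that] by (simp add: trace_nk_square)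
    then show ?thesis by (smt (verit) norm_eq_zero zero_le_power2 power2_eq_iff_nonneg zero_eq_power2)
  qed
  from z show ?thesis
  proof
    assume z: "nk 1 (- 1) 0 0 0 \<in> w" (is "?z \<in> w")
    have T: "nk 0 0 (2 * \<i> * p) (\<i> * u) (- \<i> * v) \<in> w" if "nk a b p u v \<in> w" for a b p u v
      using cl[OF z that] by (simp add: nk_bracket mult_ac)
    note y2 = T[OF T[OF y[unfolded yc]]]
    note y4 = T[OF T[OF y2]]
    \<comment> \<open>The squared adjoint map is -4 on \<open>p\<close> and -1 on \<open>u\<close>
      and \<open>v\<close>; its square plus four times itself cancels \<open>p\<close> and keeps the
      factor 1 - 4.\<close>
    have "nk 0 0 (2 * \<i> * (2 * \<i> * (2 * \<i> * (2 * \<i> * p)))) (\<i> * (\<i> * (\<i> * (\<i> * u))))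
        (- \<i> * (- \<i> * (- \<i> * (- \<i> * v)))) + 4 *\<^sub>R nk 0 0 (2 * \<i> * (2 * \<i> * p)) (\<i> * (\<i> * u)) (- \<i> * (- \<i> * v))
        = nk 0 0 0 (- 3 * u) (- 3 * v)"
      unfolding nk_scaleR nk_add nk_eq_iff by (simp add: complex_eq_iff)
    then have "nk 0 0 0 (- 3 * u) (- 3 * v) \<in> w"
      using subspace_add[OF sub y4 subspace_scale[OF sub y2, of 4]] by (simp only:)
    then have "u = 0" "v = 0" using neg_nk by fastforce+
    then show ?thesis using yc by blast
  next
    assume z: "nk 0 1 0 0 0 \<in> w" (is "?z \<in> w")
    have T: "nk 0 0 (- \<i> * p) (\<i> * u) (2 * \<i> * v) \<in> w" if "nk a b p u v \<in> w" for a b p u v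
      using cl[OF z that] by (simp add: nk_bracket mult_ac)
    note y2 = T[OF T[OF y[unfolded yc]]]
    note y4 = T[OF T[OF y2]]
    \<comment> \<open>Now the squared adjoint map is -1 on \<open>p\<close> and \<open>u\<close> and
      -4 on \<open>v\<close>; its square plus itself leaves only \<open>v\<close>, with factor 16 -
      4.\<close>
    have "nk 0 0 (- \<i> * (- \<i> * (- \<i> * (- \<i> * p)))) (\<i> * (\<i> * (\<i> * (\<i> * u))))
        (2 * \<i> * (2 * \<i> * (2 * \<i> * (2 * \<i> * v)))) + nk 0 0 (- \<i> * (- \<i> * p)) (\<i> * (\<i> * u)) (2 * \<i> * (2 * \<i> * v))
        = nk 0 0 0 0 (12 * v)"
      unfolding nk_add nk_eq_iff by (simp add: complex_eq_iff)
    then have "nk 0 0 0 0 (12 * v) \<in> w"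
      using subspace_add[OF sub y4 y2] by (simp only:)
    then have v: "v = 0" using neg_nk by fastforce
    \<comment> \<open>On \<open>p\<close> and \<open>u\<close> the eigenvalues are
      \<open>- \<i>\<close> and \<open>\<i>\<close>, which no real polynomial separates. A second
      diagonal element, the bracket of \<open>Y\<close> with its image under the adjoint map, is
      used instead.\<close>
    define Y where "Y = nk 0 0 p u 0"
    have Y: "Y \<in> w"
      using subspace_scale[OF sub y2, of "- 1"] by (simp add: Y_def v nk_scaleR mult.assoc[symmetric])
    have TY: "nk 0 0 (- \<i> * p) (\<i> * u) 0 \<in> w" using T[OF Y[unfolded Y_def]] by simp
    define P U where "P = (Re p)\<^sup>2 + (Im p)\<^sup>2" and "U = (Re u)\<^sup>2 + (Im u)\<^sup>2"
    have "bracket Y (nk 0 0 (- \<i> * p) (\<i> * u) 0) = nk (- 2 * (P + U)) (2 * P) 0 0 0"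
      by (simp add: Y_def nk_bracket nk_eq_iff P_def U_def power2_eq_square algebra_simps)
    then have D: "nk (- 2 * (P + U)) (2 * P) 0 0 0 \<in> w" using cl[OF Y TY] by simp
    \<comment> \<open>The bracket multiplies \<open>p\<close> by \<open>- (4 * P + 2 * U)\<close>
      and \<open>u\<close> by \<open>2 * P + 4 * U\<close>, so this multiple of \<open>Y\<close>
      cancels \<open>p\<close>.\<close>
    have "bracket (nk (- 2 * (P + U)) (2 * P) 0 0 0) (nk 0 0 (- \<i> * p) (\<i> * u) 0) + (4 * P + 2 * U) *\<^sub>R Y \<in> w"
      by (intro subspace_add[OF sub] subspace_scale[OF sub] cl D TY Y)
    moreover have "bracket (nk (- 2 * (P + U)) (2 * P) 0 0 0) (nk 0 0 (- \<i> * p) (\<i> * u) 0) + (4 * P + 2 * U) *\<^sub>R Y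
        = nk 0 0 0 (6 * (P + U) * u) 0"
      by (simp add: Y_def nk_bracket nk_scaleR nk_add nk_eq_iff) (simp add: algebra_simps)
    ultimately have "complex_of_real (6 * (P + U)) * u = 0" using neg_nk by fastforce
    then have "u = 0 \<or> P + U = 0" unfolding mult_eq_0_iff of_real_eq_0_iff by auto
    moreover have "P + U = 0 \<Longrightarrow> u = 0"
      unfolding P_def U_def by (auto simp: complex_eq_iff add_nonneg_eq_0_iff)
    ultimately show ?thesis using yc v by blast
  qed
qed

lemma nk_in_su2_span: "nk x (- x) p 0 0 \<in> span {nk 1 (- 1) 0 0 0, nk 0 0 1 0 0, nk 0 0 \<i> 0 0}"
proof -
  have "x *\<^sub>R nk 1 (- 1) 0 0 0 + Re p *\<^sub>R nk 0 0 1 0 0 + Im p *\<^sub>R nk 0 0 \<i> 0 0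
      \<in> span {nk 1 (- 1) 0 0 0, nk 0 0 1 0 0, nk 0 0 \<i> 0 0}"
    by (intro span_add span_scale span_base) simp_all
  moreover have "x *\<^sub>R nk 1 (- 1) 0 0 0 + Re p *\<^sub>R nk 0 0 1 0 0 + Im p *\<^sub>R nk 0 0 \<i> 0 0 = nk x (- x) p 0 0"
    by (simp add: nk_scaleR nk_add nk_eq_iff complex_eq_iff)
  ultimately show ?thesis by simp
qed

text \<open>u(2) is su(2) plus the centre, which is spanned by \<open>nk 1 1 0 0 0\<close>.\<close>

lemma eq_su2:
  assumes ss: "lie_semisimple w" and sub: "subspace w" and ne: "w \<noteq> {0}"
    and cl: "\<And>x y. x \<in> w \<Longrightarrow> y \<in> w \<Longrightarrow> bracket x y \<in> w"
    and u2: "\<And>y. y \<in> w \<Longrightarrow> \<exists>a b p. y = nk a b p 0 0"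
  shows "w = span {nk 1 (- 1) 0 0 0, nk 0 0 1 0 0, nk 0 0 \<i> 0 0}"
proof (rule semisimple_in_central_extension[OF ss sub ne cl])
  fix x y assume "x \<in> w" "y \<in> w"
  then obtain a b p a' b' p' where xy: "x = nk a b p 0 0" "y = nk a' b' p' 0 0" using u2 by metis
  show "bracket x y \<in> span {nk 1 (- 1) 0 0 0, nk 0 0 1 0 0, nk 0 0 \<i> 0 0}"
    using nk_in_su2_span[of "2 * Im (p' * cnj p)"] unfolding xy nk_bracket by (simp add: mult_ac)
next
  fix x assume "x \<in> w"
  then obtain a b p where x: "x = nk a b p 0 0" using u2 by blast
  have half: "a - (a + b) / 2 = (a - b) / 2" "b - (a + b) / 2 = - ((a - b) / 2)" by argo+
  have "x - ((a + b) / 2) *\<^sub>R nk 1 1 0 0 0 = nk ((a - b) / 2) (- ((a - b) / 2)) p 0 0"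
    unfolding x nk_scaleR nk_diff nk_eq_iff by (simp only: half mult_1_right mult_zero_right diff_zero simp_thms)
  then show "\<exists>k. x - k *\<^sub>R nk 1 1 0 0 0 \<in> span {nk 1 (- 1) 0 0 0, nk 0 0 1 0 0, nk 0 0 \<i> 0 0}"
    using nk_in_su2_span by metis
  show "bracket x (nk 1 1 0 0 0) = 0" by (simp add: x nk_bracket nk_zero)
qed

section \<open>The three standard algebras\<close>

lemma linear_conjugation: "linear (\<lambda>x :: complex^3^3. Q ** x ** P)"
  by (rule linearI) (simp_all add: matrix_linear_simps)

lemma conjugation_mult:
  fixes P Q x y :: "complex^3^3"
  assumes "P ** Q = mat 1"
  shows "(Q ** x ** P) ** (Q ** y ** P) = Q ** (x ** y) ** P"
proof -
  have "(Q ** x ** P) ** (Q ** y ** P) = Q ** x ** (P ** Q) ** y ** P" by (simp only: matrix_mul_assoc)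
  then show ?thesis by (simp add: assms matrix_mul_assoc)
qed

lemma conjugation_bracket:
  fixes P Q x y :: "complex^3^3"
  assumes "P ** Q = mat 1"
  shows "Q ** bracket x y ** P = bracket (Q ** x ** P) (Q ** y ** P)"
  unfolding bracket_def conjugation_mult[OF assms] by (simp add: matrix_linear_simps)

lemma conjugation_inverse:
  fixes P Q x :: "complex^3^3"
  assumes "P ** Q = mat 1"
  shows "P ** (Q ** x ** P) ** Q = x"
proof -
  have "P ** (Q ** x ** P) ** Q = (P ** Q) ** x ** (P ** Q)" by (simp only: matrix_mul_assoc)
  then show ?thesis by (simp add: assms)
qed

lemma trace_conjugation:
  fixes P Q x :: "complex^3^3"
  assumes "P ** Q = mat 1"
  shows "trace (Q ** x ** P) = trace x"
proof -
  have "trace (Q ** x ** P) = trace (P ** (Q ** x))" by (rule trace_mult_commute)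
  then show ?thesis by (simp add: matrix_mul_assoc assms)
qed

lemma frame_image:
  assumes F: "frame M P Q" and v: "lie_subalgebra v su21"
  defines "w \<equiv> (\<lambda>x. Q ** x ** P) ` v"
  shows "w \<subseteq> su_form M" "subspace w" "\<And>x y. x \<in> w \<Longrightarrow> y \<in> w \<Longrightarrow> bracket x y \<in> w"
    and "lie_semisimple v \<Longrightarrow> lie_semisimple w"
    and "v \<noteq> {0} \<Longrightarrow> w \<noteq> {0}"
    and "v \<noteq> su21 \<Longrightarrow> w \<noteq> su_form M"
    and "(\<And>x. x \<in> v \<Longrightarrow> Re (trace (x ** x)) \<le> 0) \<Longrightarrow> (\<And>x. x \<in> w \<Longrightarrow> Re (trace (x ** x)) \<le> 0)"
proof -
  let ?f = "\<lambda>x. Q ** x ** P"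
  let ?g = "\<lambda>x. P ** x ** Q"
  have PQ: "P ** Q = mat 1" and QP: "Q ** P = mat 1" using F by (simp_all add: frame_def)
  have v_su: "v \<subseteq> su21" and v_sub: "subspace v"
    and v_cl: "\<And>x y. x \<in> v \<Longrightarrow> y \<in> v \<Longrightarrow> bracket x y \<in> v"
    using v by (simp_all add: lie_subalgebra_def)
  note gf = conjugation_inverse[OF PQ]
  note fg = conjugation_inverse[OF QP]
  show "w \<subseteq> su_form M"
    unfolding w_def using frame_pullback[OF F] v_su by auto
  show "subspace w" unfolding w_def by (rule linear_subspace_image[OF linear_conjugation v_sub])
  show "bracket x y \<in> w" if xy: "x \<in> w" "y \<in> w" for x y
  proof -
    obtain x' y' where "x' \<in> v" "y' \<in> v" "x = ?f x'" "y = ?f y'" using xy unfolding w_def by auto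
    then show ?thesis
      unfolding w_def by (simp add: conjugation_bracket[OF PQ, symmetric] imageI v_cl)
  qed
  show "lie_semisimple w" if "lie_semisimple v"
    unfolding w_def
    by (rule lie_semisimple_image[where g = ?g])
      (simp_all only: linear_conjugation conjugation_bracket[OF PQ] conjugation_bracket[OF QP] gf fg that)
  show "w \<noteq> {0}" if "v \<noteq> {0}"
  proof
    assume "w = {0}"
    have "v = ?g ` w" unfolding w_def image_image gf by simp
    also have "\<dots> = {0}" unfolding \<open>w = {0}\<close> using linear_0[OF linear_conjugation[of P Q]] by simp
    finally show False using that by contradiction
  qed
  show "w \<noteq> su_form M" if "v \<noteq> su21"
  proof
    assume eq: "w = su_form M"
    have "y \<in> v" if "y \<in> su21" for y
    proof -
      have "?f y \<in> w" using frame_pullback[OF F that] eq by simp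
      then obtain x where "x \<in> v" "?f y = ?f x" unfolding w_def by auto
      then show ?thesis using gf[of x] gf[of y] by metis
    qed
    then show False using v_su that by auto
  qed
  show "Re (trace (x ** x)) \<le> 0" if neg: "\<And>x. x \<in> v \<Longrightarrow> Re (trace (x ** x)) \<le> 0" and "x \<in> w" for x
    using that(2) unfolding w_def by (auto simp: conjugation_mult[OF PQ] trace_conjugation[OF PQ] neg)
qed

lemma span_triple_eqI:
  assumes "\<And>x y z. x *\<^sub>R a + y *\<^sub>R b + z *\<^sub>R c \<in> S"
    and "\<And>s. s \<in> S \<Longrightarrow> \<exists>x y z. s = x *\<^sub>R a + y *\<^sub>R b + z *\<^sub>R c"
  shows "span {a, b, c} = S"
proof (intro subset_antisym subsetI)
  fix s assume "s \<in> span {a, b, c}"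
  then show "s \<in> S" using assms(1) by (metis span_tripleE)
next
  fix s assume "s \<in> S"
  then obtain x y z where "s = x *\<^sub>R a + y *\<^sub>R b + z *\<^sub>R c" using assms(2) by blast
  moreover have "x *\<^sub>R a + y *\<^sub>R b + z *\<^sub>R c \<in> span {a, b, c}"
    by (intro span_add span_scale span_base) simp_all
  ultimately show "s \<in> span {a, b, c}" by simp
qed

lemma frame_image_span:
  "(\<lambda>x :: complex^3^3. Q ** x ** P) ` span {a, b, c} = span {Q ** a ** P, Q ** b ** P, Q ** c ** P}"
  using linear_span_image[OF linear_conjugation[of Q P], of "{a, b, c}"] by simp

lemma frame_v36:
  "frame N21 (mat 1) (mat 1)"
  "(\<lambda>x. mat 1 ** x ** mat 1) ` v36 = span {nk 1 (- 1) 0 0 0, nk 0 0 1 0 0, nk 0 0 \<i> 0 0}"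
proof -
  show "frame N21 (mat 1) (mat 1)" by (simp add: frame_def conj_transpose_mat)
  show "(\<lambda>x. mat 1 ** x ** mat 1) ` v36 = span {nk 1 (- 1) 0 0 0, nk 0 0 1 0 0, nk 0 0 \<i> 0 0}"
    by (simp add: v36_def A_mat3 nk_def)
qed

text \<open>The first and third columns are isotropic eigenvectors of \<open>A5\<close> for 1 and
  -1, scaled to pair to one; the matrix is its own inverse.\<close>

lemma frame_v35:
  obtains P Q where "frame J21 P Q"
    "(\<lambda>x. Q ** x ** P) ` v35 = span {mk 0 0 0 1 1, mk 1 0 0 0 0, mk 0 0 0 (- 1) 1}"
proof -
  define r where "r = complex_of_real (1 / sqrt 2)"
  have r: "r * r = 1 / 2" "cnj r = r" by (simp_all add: r_def of_real_mult[symmetric] del: of_real_mult)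
  let ?P = "mat3 r 0 r 0 1 0 r 0 (- r)"
  have "frame J21 ?P ?P"
    by (simp add: frame_def N21_mat3 J21_def mat3_simps r)
  moreover have "(\<lambda>x. ?P ** x ** ?P) ` v35 = span {mk 0 0 0 1 1, mk 1 0 0 0 0, mk 0 0 0 (- 1) 1}"
    unfolding v35_def frame_image_span
    by (simp add: A_mat3 mk_def mat3_mult mat3_add mult.assoc mult.left_commute r)
  ultimately show ?thesis by (rule that)
qed

text \<open>The first and third columns are isotropic eigenvectors of \<open>A6\<close> for 1 and
  -1. The phase of the middle unit vector is free and absorbs the \<omega> of the given
  subalgebra.\<close>

lemma frame_v34:
  assumes "\<omega> * cnj \<omega> = 1"
  obtains P Q where "frame J21 P Q" "(\<lambda>x. Q ** x ** P) ` v34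
    = {mk (complex_of_real r) (complex_of_real p * \<omega>) (complex_of_real q * cnj \<omega>) 0 0 | r p q. True}"
proof -
  define \<rho> where "\<rho> = 1 / sqrt 2"
  define r where "r = complex_of_real \<rho>"
  have r: "r * r = 1 / 2" "cnj r = r"
    by (simp_all add: r_def \<rho>_def of_real_mult[symmetric] del: of_real_mult)
  have w: "cnj \<omega> * \<omega> = 1" using assms by (simp add: mult.commute)
  have i: "\<i> * a * (\<i> * b) = - (a * b)" for a b by (simp add: complex_eq_iff)
  let ?P = "mat3 r 0 r 0 (\<i> * \<omega>) 0 (- \<i> * r) 0 (\<i> * r)"
  let ?Q = "mat3 r 0 (\<i> * r) 0 (- \<i> * cnj \<omega>) 0 r 0 (- \<i> * r)"
  let ?S = "{mk (complex_of_real r) (complex_of_real p * \<omega>) (complex_of_real q * cnj \<omega>) 0 0 | r p q. True}"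
  have "frame J21 ?P ?Q"
    by (simp add: frame_def N21_mat3 J21_def mat3_simps r assms w i)
  moreover have "(\<lambda>x. ?Q ** x ** ?P) ` v34 = ?S"
  proof -
    have "(\<lambda>x. ?Q ** x ** ?P) ` v34
        = span {mk 0 (- r * \<omega>) (r * cnj \<omega>) 0 0, mk 1 0 0 0 0, mk 0 (- r * \<omega>) (- r * cnj \<omega>) 0 0}"
      unfolding v34_def frame_image_span
      by (simp add: A_mat3 mk_def mat3_mult mat3_add mult.assoc mult.left_commute r mult.commute[of "cnj \<omega>" r])
    also have "\<dots> = ?S"
    proof (rule span_triple_eqI)
      have comb: "x *\<^sub>R mk 0 (- r * \<omega>) (r * cnj \<omega>) 0 0 + y *\<^sub>R mk 1 0 0 0 0
            + z *\<^sub>R mk 0 (- r * \<omega>) (- r * cnj \<omega>) 0 0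
          = mk (complex_of_real y) (complex_of_real (- (x + z) * \<rho>) * \<omega>) (complex_of_real ((x - z) * \<rho>) * cnj \<omega>) 0 0"
        for x y z by (simp add: mk_scaleR mk_add mk_eq_iff r_def algebra_simps)
      show "x *\<^sub>R mk 0 (- r * \<omega>) (r * cnj \<omega>) 0 0 + y *\<^sub>R mk 1 0 0 0 0
          + z *\<^sub>R mk 0 (- r * \<omega>) (- r * cnj \<omega>) 0 0 \<in> ?S" for x y z
        unfolding comb by blast
      fix s assume "s \<in> ?S"
      then obtain y p q where s: "s = mk (complex_of_real y) (complex_of_real p * \<omega>) (complex_of_real q * cnj \<omega>) 0 0"
        by blast
      define x z where "x = (q - p) / (2 * \<rho>)" and "z = - (q + p) / (2 * \<rho>)"
      have "\<rho> \<noteq> 0" by (simp add: \<rho>_def)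
      then have p: "- (x + z) * \<rho> = p" and q: "(x - z) * \<rho> = q" by (simp_all add: x_def z_def field_simps)
      have "s = x *\<^sub>R mk 0 (- r * \<omega>) (r * cnj \<omega>) 0 0 + y *\<^sub>R mk 1 0 0 0 0
            + z *\<^sub>R mk 0 (- r * \<omega>) (- r * cnj \<omega>) 0 0"
        unfolding comb p q by (rule s)
      then show "\<exists>x y z. s = x *\<^sub>R mk 0 (- r * \<omega>) (r * cnj \<omega>) 0 0 + y *\<^sub>R mk 1 0 0 0 0
          + z *\<^sub>R mk 0 (- r * \<omega>) (- r * cnj \<omega>) 0 0" by blast
    qed
    finally show ?thesis .
  qed
  ultimately show ?thesis by (rule that)
qed

section \<open>The standard algebras are semisimple and proper\<close>

lemma subspace_su21: "subspace su21"
proof -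
  have "x \<in> su21 \<longleftrightarrow> (\<exists>a b w u v. x = nk a b w u v)" for x
    using nk_in_su21 su21_eq_su_form su_form_N21E by metis
  then show ?thesis
    unfolding subspace_def using nk_zero nk_add nk_scaleR by metis
qed

lemma basis_in_su21: "A1 \<in> su21" "A2 \<in> su21" "A3 \<in> su21" "A4 \<in> su21" "A5 \<in> su21" "A6 \<in> su21" "A7 \<in> su21"
proof -
  have eqs: "A1 = nk 1 (- 1) 0 0 0" "A2 = nk 0 1 0 0 0" "A3 = nk 0 0 1 0 0" "A4 = nk 0 0 \<i> 0 0"
    "A5 = nk 0 0 0 1 0" "A6 = nk 0 0 0 \<i> 0" "A7 = nk 0 0 0 0 1"
    by (simp_all add: A_mat3 nk_def)
  show "A1 \<in> su21" "A2 \<in> su21" "A3 \<in> su21" "A4 \<in> su21" "A5 \<in> su21" "A6 \<in> su21" "A7 \<in> su21"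
    unfolding eqs by (rule nk_in_su21)+
qed

lemma semisimple_proper_span_triple:
  assumes "bracket a b = \<gamma> *\<^sub>R c" "bracket b c = \<alpha> *\<^sub>R a" "bracket c a = \<beta> *\<^sub>R b"
    and "\<alpha> \<noteq> 0" "\<beta> \<noteq> 0" "\<gamma> \<noteq> 0"
    and "a \<in> su21" "b \<in> su21" "c \<in> su21" "a \<noteq> 0" "d \<in> su21" "d \<notin> span {a, b, c}"
  shows "semisimple_proper_subalgebra (span {a, b, c})"
  unfolding semisimple_proper_subalgebra_def lie_subalgebra_def
proof (intro conjI ballI)
  show "span {a, b, c} \<subseteq> su21" using assms(7-9) subspace_su21 by (intro span_minimal) simp_all
  show "span {a, b, c} \<noteq> {0}" using span_base[of a "{a, b, c}"] assms(10) by auto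
  show "span {a, b, c} \<noteq> su21" using assms(11,12) by auto
qed (use lie_semisimple_span_triple[OF assms(1-6)] in auto)

lemma v34_semisimple: "semisimple_proper_subalgebra v34"
  unfolding v34_def
proof (rule semisimple_proper_span_triple[where d = A5])
  show "bracket A4 A6 = (- 1) *\<^sub>R A7" "bracket A6 A7 = 1 *\<^sub>R A4" "bracket A7 A4 = (- 1) *\<^sub>R A6"
    by (simp_all add: bracket_def A_mat3 mat3_mult mat3_diff mat3_scaleR)
  show "A4 \<noteq> 0" by (simp add: A_mat3 mat3_zero mat3_eq_iff)
  show "A5 \<notin> span {A4, A6, A7}"
  proof
    assume "A5 \<in> span {A4, A6, A7}"
    then obtain x y z where "A5 = x *\<^sub>R A4 + y *\<^sub>R A6 + z *\<^sub>R A7" by (rule span_tripleE)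
    then show False by (simp add: A_mat3 mat3_scaleR mat3_add mat3_eq_iff complex_eq_iff)
  qed
qed (simp_all add: basis_in_su21)

lemma v35_semisimple: "semisimple_proper_subalgebra v35"
  unfolding v35_def
proof (rule semisimple_proper_span_triple[where d = A7])
  show "bracket (A1 + A2) A5 = 2 *\<^sub>R A6" "bracket A5 A6 = (- 2) *\<^sub>R (A1 + A2)" "bracket A6 (A1 + A2) = 2 *\<^sub>R A5"
    by (simp_all add: bracket_def A_mat3 mat3_mult mat3_add mat3_diff mat3_scaleR)
  show "A1 + A2 \<in> su21" by (intro subspace_add subspace_su21 basis_in_su21)
  show "A1 + A2 \<noteq> 0" by (simp add: A_mat3 mat3_add mat3_zero mat3_eq_iff)
  show "A7 \<notin> span {A1 + A2, A5, A6}"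
  proof
    assume "A7 \<in> span {A1 + A2, A5, A6}"
    then obtain x y z where "A7 = x *\<^sub>R (A1 + A2) + y *\<^sub>R A5 + z *\<^sub>R A6" by (rule span_tripleE)
    then show False by (simp add: A_mat3 mat3_scaleR mat3_add mat3_eq_iff complex_eq_iff)
  qed
qed (simp_all add: basis_in_su21)

lemma v36_semisimple: "semisimple_proper_subalgebra v36"
  unfolding v36_def
proof (rule semisimple_proper_span_triple[where d = A7])
  show "bracket A1 A3 = 2 *\<^sub>R A4" "bracket A3 A4 = 2 *\<^sub>R A1" "bracket A4 A1 = 2 *\<^sub>R A3"
    by (simp_all add: bracket_def A_mat3 mat3_mult mat3_add mat3_diff mat3_scaleR)
  show "A1 \<noteq> 0" by (simp add: A_mat3 mat3_add mat3_zero mat3_eq_iff)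
  show "A7 \<notin> span {A1, A3, A4}"
  proof
    assume "A7 \<in> span {A1, A3, A4}"
    then obtain x y z where "A7 = x *\<^sub>R A1 + y *\<^sub>R A3 + z *\<^sub>R A4" by (rule span_tripleE)
    then show False by (simp add: A_mat3 mat3_scaleR mat3_add mat3_eq_iff complex_eq_iff)
  qed
qed (simp_all add: basis_in_su21)

lemma SU21_conjugateE:
  assumes "SU21_conjugate v w"
  obtains g h where "g ** h = mat 1" "h ** g = mat 1" "w = (\<lambda>x. g ** x ** h) ` v"
proof -
  obtain g where g: "g \<in> SU21" "w = (\<lambda>x. g ** x ** matrix_inv g) ` v"
    using assms unfolding SU21_conjugate_def by blast
  have "det g \<noteq> 0" using g(1) by (simp add: SU21_def)
  then obtain h where h: "g ** h = mat 1" "h ** g = mat 1"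
    using invertible_det_nz[of g] unfolding invertible_def by metis
  show ?thesis using that[OF h] g(2) unfolding matrix_inv_eqI[OF h] .
qed

text \<open>Conjugation preserves the trace form, which is negative definite on su(2).\<close>

lemma not_conjugate_v36:
  assumes "x \<in> v" "Re (trace (x ** x)) > 0"
  shows "\<not> SU21_conjugate v v36"
proof
  assume "SU21_conjugate v v36"
  then obtain g h where gh: "g ** h = mat 1" "h ** g = mat 1" and eq: "v36 = (\<lambda>x. g ** x ** h) ` v"
    by (rule SU21_conjugateE)
  have "g ** x ** h \<in> span {A1, A3, A4}" using assms(1) eq unfolding v36_def by auto
  then obtain a b c where y: "g ** x ** h = a *\<^sub>R A1 + b *\<^sub>R A3 + c *\<^sub>R A4" by (rule span_tripleE)
  have "trace (x ** x) = trace ((g ** x ** h) ** (g ** x ** h))"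
    by (simp add: conjugation_mult[OF gh(2)] trace_conjugation[OF gh(2)])
  also have "\<dots> = complex_of_real (- 2 * (a\<^sup>2 + b\<^sup>2 + c\<^sup>2))"
    unfolding y by (simp add: A_mat3 mat3_scaleR mat3_add mat3_mult trace_mat3)
      (simp add: complex_eq_iff power2_eq_square algebra_simps)
  finally have "Re (trace (x ** x)) = - 2 * (a\<^sup>2 + b\<^sup>2 + c\<^sup>2)" by (simp only: Re_complex_of_real)
  moreover have "0 \<le> a\<^sup>2 + b\<^sup>2 + c\<^sup>2" by simp
  ultimately show False using assms(2) by simp
qed

text \<open>The elements of \<^term>\<open>v35\<close> have a common kernel vector, those of \<^term>\<open>v34\<close> do not.\<close>

lemma not_conjugate_v34_v35: "\<not> SU21_conjugate v34 v35"
proof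
  assume "SU21_conjugate v34 v35"
  then obtain g h where gh: "g ** h = mat 1" "h ** g = mat 1" and eq: "v35 = (\<lambda>x. g ** x ** h) ` v34"
    by (rule SU21_conjugateE)
  \<comment> \<open>The projection onto the second basis vector, which \<open>v35\<close>
    annihilates; the image of that vector under \<open>h\<close> is thus handled as a
    matrix.\<close>
  let ?E = "mat3 0 0 0 0 1 0 0 0 0"
  have kill: "x ** (h ** ?E) = 0" if "x \<in> v34" for x
  proof -
    have "g ** x ** h \<in> span {A1 + A2, A5, A6}" using that eq unfolding v35_def by auto
    then obtain a b c where "g ** x ** h = a *\<^sub>R (A1 + A2) + b *\<^sub>R A5 + c *\<^sub>R A6" by (rule span_tripleE)
    then have "g ** x ** h ** ?E = 0" by (simp add: A_mat3 mat3_scaleR mat3_add mat3_mult mat3_zero)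
    then have "h ** (g ** x ** h ** ?E) = 0" by (simp add: matrix_matrix_mult_def vec_eq_iff)
    moreover have "h ** (g ** x ** h ** ?E) = (h ** g) ** (x ** (h ** ?E))" by (simp only: matrix_mul_assoc)
    ultimately show ?thesis by (simp add: gh)
  qed
  obtain a b c d e f a' b' c' where H: "h ** ?E = mat3 a b c d e f a' b' c'" by (rule mat3E)
  have "A4 \<in> v34" "A6 \<in> v34" by (simp_all add: v34_def span_base)
  \<comment> \<open>The kernels of \<open>A4\<close> and \<open>A6\<close> are the third and the
    second coordinate lines, which meet only in zero.\<close>
  then have "h ** ?E = 0" using kill[of A4] kill[of A6] unfolding H by (simp add: A_mat3 mat3_mult mat3_zero mat3_eq_iff)
  then have "g ** (h ** ?E) = 0" by (simp add: matrix_matrix_mult_def vec_eq_iff)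
  then show False by (simp add: matrix_mul_assoc gh) (simp add: mat3_zero mat3_eq_iff)
qed

lemma not_conjugate_standard: "\<not> SU21_conjugate v34 v36" "\<not> SU21_conjugate v35 v36"
proof -
  show "\<not> SU21_conjugate v34 v36"
    by (rule not_conjugate_v36[of A6]) (simp_all add: v34_def span_base A_mat3 mat3_mult trace_mat3)
  show "\<not> SU21_conjugate v35 v36"
    by (rule not_conjugate_v36[of A5]) (simp_all add: v35_def span_base A_mat3 mat3_mult trace_mat3)
qed

section \<open>Spectral data and the classification\<close>

lemma mat3_axis_eigenvector:
  "mat3 a b c d e f g h i *v axis 1 1 = k *s axis 1 1 \<longleftrightarrow> a = k \<and> d = 0 \<and> g = 0"
  "mat3 a b c d e f g h i *v axis 2 1 = k *s axis 2 1 \<longleftrightarrow> b = 0 \<and> e = k \<and> h = 0"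
  "mat3 a b c d e f g h i *v axis 3 1 = k *s axis 3 1 \<longleftrightarrow> c = 0 \<and> f = 0 \<and> i = k"
  by (auto simp: vec3_eq_iff mat3_mult_vec axis_def)

section \<open>Characteristic polynomials and eigenvalues\<close>

lemma su21E:
  assumes "z \<in> su21"
  obtains x y w u v where "z = nk x y w u v"
  using assms unfolding su21_eq_su_form by (rule su_form_N21E)

lemma trace_su21: "z \<in> su21 \<Longrightarrow> trace z = 0"
  by (simp add: su21_eq_su_form su_form_def)

lemma trace_square_su21_real:
  assumes "z \<in> su21"
  shows "trace (z ** z) = complex_of_real (Re (trace (z ** z)))"
  using assms by (rule su21E) (simp only: trace_nk_square Re_complex_of_real)

text \<open>\<open>z\<close> is minus its adjoint for the form, and in odd dimension this makes the
  determinant minus its own conjugate.\<close>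

lemma det_su21_imaginary:
  assumes "z \<in> su21"
  shows "Re (det z) = 0"
  using assms by (rule su21E) (simp add: nk_def det_mat3 algebra_simps)

lemma char_poly3:
  fixes z :: "complex^3^3"
  assumes "trace z = 0"
  shows "det (z - mat k) = det z + trace (z ** z) / 2 * k - k ^ 3"
proof -
  obtain a b c d e f g h i where z: "z = mat3 a b c d e f g h i" by (rule mat3E)
  have i: "i = - a - e" using assms by (simp add: z trace_mat3 eq_neg_iff_add_eq_0 algebra_simps)
  show ?thesis
    by (simp add: z i mat3_one mat3_diff mat3_mult trace_mat3 det_mat3 power3_eq_cube field_simps)
qed

lemma cayley_hamilton3:
  assumes "trace z = 0" "trace (z ** z) = 0" "det z = 0"
  shows "z ** (z ** z) = (0 :: complex^3^3)"
proof -
  obtain a b c d e f g h i where z: "z = mat3 a b c d e f g h i" by (rule mat3E)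
  have i: "i = - a - e" using assms(1) by (simp add: z trace_mat3 eq_neg_iff_add_eq_0 algebra_simps)
  have T: "a * a + b * d + c * g + (d * b + e * e + f * h) + (g * c + h * f + i * i) = 0"
    using assms(2) by (simp add: z mat3_mult trace_mat3)
  have D: "a * e * i + b * f * g + c * d * h - a * f * h - b * d * i - c * e * g = 0"
    using assms(3) by (simp add: z det_mat3)
  show ?thesis
    unfolding z mat3_mult mat3_zero mat3_eq_iff
    using T D unfolding i by (intro conjI; algebra)
qed

lemma cubic_root_exists:
  assumes "T > 0"
  obtains t :: real where "t ^ 3 + T * t + d = 0"
proof -
  \<comment> \<open>With this bound the linear term at \<open>M\<close> and \<open>- M\<close>
    already balances \<open>d\<close>, so the cubic changes sign between them.\<close>
  define M where "M = \<bar>d\<bar> / T"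
  have M: "M \<ge> 0" "T * M = \<bar>d\<bar>" using assms by (simp_all add: M_def)
  let ?f = "\<lambda>t :: real. t ^ 3 + T * t + d"
  have "\<exists>t. - M \<le> t \<and> t \<le> M \<and> ?f t = 0"
  proof (rule IVT')
    show "?f (- M) \<le> 0" using M by (simp add: zero_le_power)  (smt (verit) zero_le_power)
    show "0 \<le> ?f M" using M by simp (smt (verit) zero_le_power)
    show "continuous_on {- M..M} ?f" by (intro continuous_intros)
  qed (use M in simp)
  then show ?thesis using that by blast
qed

text \<open>A real root \<open>t\<close> of the cubic gives the imaginary eigenvalue
  \<open>\<i> * t\<close>. Dividing it out leaves a quadratic with roots of imaginary part
  \<open>- t / 2\<close> and real parts \<open>s / 2\<close> and \<open>- s / 2\<close>, where the
  discriminant \<open>3 * t^2 + 4 * T\<close> is positive.\<close>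

lemma hyperbolic_eigenvalue:
  assumes z: "z \<in> su21" and T: "Re (trace (z ** z)) > 0"
  obtains k where "Re k > 0" "det (z - mat k) = 0" "det (z - mat (- cnj k)) = 0"
proof -
  define T where "T = Re (trace (z ** z)) / 2"
  have T0: "T > 0" using assms(2) by (simp add: T_def)
  define d where "d = Im (det z)"
  obtain t where t: "t ^ 3 + T * t + d = 0" using cubic_root_exists[OF T0] by metis
  have D: "det z = \<i> * d" using det_su21_imaginary[OF z] by (simp add: complex_eq_iff d_def)
  have cp: "det (z - mat k) = \<i> * d + T * k - k ^ 3" for k :: complex
  proof -
    have "trace (z ** z) / 2 = complex_of_real T"
      using trace_square_su21_real[OF z] by (simp add: T_def)
    then show ?thesis unfolding char_poly3[OF trace_su21[OF z]] D by simp
  qed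
  define s where "s = sqrt (3 * t\<^sup>2 + 4 * T)"
  have s: "s\<^sup>2 = 3 * t\<^sup>2 + 4 * T" "s > 0"
    using T0 by (simp_all add: s_def add_nonneg_pos)
  have root: "det (z - mat (Complex (r / 2) (- t / 2))) = 0" if "r\<^sup>2 = 3 * t\<^sup>2 + 4 * T" for r
  proof -
    have d: "d = - (t * t * t) - T * t" using t by (simp add: power3_eq_cube)
    have r: "r * r = 3 * (t * t) + 4 * T" using that by (simp add: power2_eq_square)
    have "r * r * r = r * (3 * (t * t) + 4 * T)" "r * r * t = (3 * (t * t) + 4 * T) * t" by (simp_all add: r)
    then show ?thesis
      unfolding cp complex_eq_iff by (simp add: d power3_eq_cube field_simps)
  qed
  show ?thesis
  proof (rule that[of "Complex (s / 2) (- t / 2)"])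
    have "- cnj (Complex (s / 2) (- t / 2)) = Complex (- s / 2) (- t / 2)" by (simp add: complex_eq_iff)
    then show "det (z - mat (- cnj (Complex (s / 2) (- t / 2)))) = 0" using root[of "- s"] s(1) by simp
  qed (use s root[of s] in simp_all)
qed

lemma eigenvectors_orthogonal:
  assumes "z \<in> su21" "z *v e = k *s e" "z *v f = m *s f" "k + cnj m \<noteq> 0"
  shows "herm e f = 0"
proof -
  have "k * herm e f = - (cnj m * herm e f)"
    using herm_skew[OF assms(1), of e f] by (simp add: assms(2,3) herm_scale_left herm_scale_right)
  then have "(k + cnj m) * herm e f = 0" by (simp add: algebra_simps)
  then show ?thesis using assms(4) by simp
qed

lemma eigenvector_scale:
  fixes z :: "complex^3^3"
  assumes "z *v e = k *s e"
  shows "z *v (c *s e) = k *s (c *s e)"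
proof -
  have "z *v (c *s e) = c *s (z *v e)"
    by (cases z rule: mat3E) (simp add: vec3_eq_iff mat3_mult_vec algebra_simps)
  then show ?thesis by (simp add: assms vec3_eq_iff)
qed

lemma hyperbolic_case:
  assumes v: "lie_subalgebra v su21" "v \<noteq> su21" "lie_semisimple v"
    and x: "x \<in> v" "Re (trace (x ** x)) > 0"
  shows "SU21_conjugate v v34 \<or> SU21_conjugate v v35"
proof -
  have xs: "x \<in> su21" using v(1) x(1) unfolding lie_subalgebra_def by auto
  obtain k where k: "Re k > 0" "det (x - mat k) = 0" "det (x - mat (- cnj k)) = 0"
    using hyperbolic_eigenvalue[OF xs x(2)] .
  obtain e where e: "e \<noteq> 0" "x *v e = k *s e" using k(2) by (rule eigenvector_exists)
  obtain f where f: "f \<noteq> 0" "x *v f = (- cnj k) *s f" using k(3) by (rule eigenvector_exists)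
  have "herm e e = 0" by (rule eigenvectors_orthogonal[OF xs e(2) e(2)]) (use k(1) in \<open>simp add: complex_eq_iff\<close>)
  have "herm f f = 0" by (rule eigenvectors_orthogonal[OF xs f(2) f(2)]) (use k(1) in \<open>simp add: complex_eq_iff\<close>)
  \<comment> \<open>Orthogonal isotropic vectors would be proportional, yet they belong to different
    eigenvalues.\<close>
  have "herm e f \<noteq> 0"
  proof
    assume "herm e f = 0"
    then obtain c where c: "f = c *s e"
      using isotropic_orthogonal \<open>herm e e = 0\<close> \<open>herm f f = 0\<close> e(1) by metis
    then have eq: "k *s f = (- cnj k) *s f" using eigenvector_scale[OF e(2), of c] f(2) by simp
    have "(k + cnj k) * f$i = 0" for i
      using arg_cong[OF eq, of "\<lambda>u. u$i"] by (simp add: algebra_simps)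
    moreover have "k + cnj k \<noteq> 0" using k(1) by (simp add: complex_eq_iff)
    ultimately have "f = 0" by (simp add: vec_eq_iff)
    then show False using f(1) by simp
  qed
  define c where "c = cnj (1 / herm e f)"
  have ef: "herm e (c *s f) = 1" "herm (c *s f) (c *s f) = 0"
    using \<open>herm e f \<noteq> 0\<close> \<open>herm f f = 0\<close> by (simp_all add: herm_scale_left herm_scale_right c_def)
  obtain P Q where F: "frame J21 P Q" and P: "P *v axis 1 1 = e" "P *v axis 3 1 = c *s f"
    using null_frame[OF \<open>herm e e = 0\<close> ef(2,1)] .
  define w where "w = (\<lambda>x. Q ** x ** P) ` v"
  note fi = frame_image[OF F v(1), folded w_def]
  have "Q ** x ** P \<in> su_form J21" using fi(1) x(1) unfolding w_def by auto
  then obtain c' b g s t where X: "Q ** x ** P = mk c' b g s t" by (rule su_form_J21E)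
  have "mk c' b g s t *v axis 1 1 = k *s axis 1 1"
    using frame_eigenvector[OF F P(1) e(2)] unfolding X .
  moreover have "mk c' b g s t *v axis 3 1 = (- cnj k) *s axis 3 1"
    using frame_eigenvector[OF F P(2) eigenvector_scale[OF f(2)]] unfolding X .
  \<comment> \<open>The first and third columns already contain all of \<open>b\<close>,
    \<open>g\<close>, \<open>s\<close>, \<open>t\<close>, so two eigenvectors suffice to make the
    matrix diagonal.\<close>
  ultimately have "mk c' b g s t = mk k 0 0 0 0"
    unfolding mk_def mat3_axis_eigenvector mat3_eq_iff by simp
  then have "mk k 0 0 0 0 \<in> w" using x(1) X unfolding w_def by force
  interpret hyperbolic_subalgebra w k
    by unfold_locales (use fi(1-3) \<open>mk k 0 0 0 0 \<in> w\<close> k(1) in auto)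
  show ?thesis
  proof (cases "upper = {0}")
    case True
    then have "lower = {0}" using simple_roots_opposite[OF fi(4)[OF v(3)]] by simp
    then have "w = span {mk 0 0 0 1 1, mk 1 0 0 0 0, mk 0 0 0 (- 1) 1}"
      using no_simple_roots[OF fi(4)[OF v(3)] True] by simp
    moreover obtain P' Q' where "frame J21 P' Q'"
      "(\<lambda>x. Q' ** x ** P') ` v35 = span {mk 0 0 0 1 1, mk 1 0 0 0 0, mk 0 0 0 (- 1) 1}"
      by (rule frame_v35)
    ultimately show ?thesis using SU21_conjugate_frames[OF F, of P' Q' v v35] unfolding w_def by simp
  next
    case False
    then have "lower \<noteq> {0}" using simple_roots_opposite[OF fi(4)[OF v(3)]] by simp
    obtain \<omega> where om: "\<omega> * cnj \<omega> = 1" and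
      w: "w = {mk (complex_of_real r) (complex_of_real p * \<omega>) (complex_of_real q * cnj \<omega>) 0 0 | r p q. True}"
      using simple_roots[OF fi(6)[OF v(2)] False \<open>lower \<noteq> {0}\<close>] .
    obtain P' Q' where F': "frame J21 P' Q'" "(\<lambda>x. Q' ** x ** P') ` v34
        = {mk (complex_of_real r) (complex_of_real p * \<omega>) (complex_of_real q * cnj \<omega>) 0 0 | r p q. True}"
      using frame_v34[OF om] .
    then have "(\<lambda>x. Q ** x ** P) ` v = (\<lambda>x. Q' ** x ** P') ` v34"
      using w unfolding w_def by (simp only:)
    then show ?thesis using SU21_conjugate_frames[OF F F'(1)] by blast
  qed
qed

text \<open>
  On \<^term>\<open>su21\<close> the determinant is imaginary and odd, so it changes sign, hence vanishes, along a
  half circle in any two-dimensional subspace.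
\<close>

lemma singular_element_exists:
  assumes v: "lie_subalgebra v su21" "\<not> lie_solvable v"
  obtains z where "z \<in> v" "z \<noteq> 0" "det z = 0"
proof -
  have sub: "subspace v" and vs: "v \<subseteq> su21" using v(1) by (simp_all add: lie_subalgebra_def)
  \<comment> \<open>Elements that do not commute are linearly independent, so the half circle
    through \<open>x\<close> and \<open>y\<close> avoids zero.\<close>
  obtain x y where xy: "x \<in> v" "y \<in> v" "bracket x y \<noteq> 0"
    using lie_solvable_abelian v(2) by metis
  define h where "h \<theta> = cos \<theta> *\<^sub>R x + sin \<theta> *\<^sub>R y" for \<theta> :: real
  have hv: "h \<theta> \<in> v" for \<theta> unfolding h_def by (intro subspace_add[OF sub] subspace_scale[OF sub] xy)
  have h0: "h \<theta> \<noteq> 0" for \<theta>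
  proof
    assume h: "h \<theta> = 0"
    have "bracket x (h \<theta>) = sin \<theta> *\<^sub>R bracket x y" "bracket (h \<theta>) y = cos \<theta> *\<^sub>R bracket x y"
      by (simp_all add: h_def bracket_simps)
    then have "sin \<theta> = 0" "cos \<theta> = 0" using xy(3) by (simp_all add: h bracket_simps)
    then show False using sin_cos_squared_add[of \<theta>] by simp
  qed
  have cont: "continuous_on S (\<lambda>\<theta>. Im (det (h \<theta>)))" for S
    unfolding h_def det_3 by (simp add: scaleR_conv_of_real[where 'a = complex]) (intro continuous_intros)
  have hpi: "det (h pi) = - det (h 0)"
    unfolding h_def det_3 by (simp add: algebra_simps)
  have "\<exists>\<theta>. Im (det (h \<theta>)) = 0"
  proof (cases "Im (det (h 0)) \<le> 0")
    case True
    then show ?thesis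
      using IVT'[of "\<lambda>\<theta>. Im (det (h \<theta>))" 0 0 pi] cont hpi by auto
  next
    case False
    then show ?thesis
      using IVT2'[of "\<lambda>\<theta>. Im (det (h \<theta>))" pi 0 0] cont hpi by auto
  qed
  then obtain \<theta> where "Im (det (h \<theta>)) = 0" by blast
  moreover have "Re (det (h \<theta>)) = 0" using det_su21_imaginary vs hv by blast
  ultimately have "det (h \<theta>) = 0" by (simp add: complex_eq_iff)
  then show ?thesis using that hv h0 by blast
qed

text \<open>As first vector of a null frame, \<open>e\<close> makes \<open>z\<close> upper
  triangular with diagonal \<open>c\<close>, \<open>cnj c - c\<close>, \<open>- cnj c\<close>.
  Singularity makes \<open>c\<close> zero or real, and a nonzero real \<open>c\<close> would give
  positive trace; so \<open>z\<close> is nilpotent and the subalgebra solvable.\<close>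

lemma no_isotropic_eigenvector:
  assumes v: "lie_subalgebra v su21" "\<not> lie_solvable v"
    and neg: "\<And>x. x \<in> v \<Longrightarrow> Re (trace (x ** x)) \<le> 0"
    and z: "z \<in> v" "z \<noteq> 0" "det z = 0" and e: "z *v e = k *s e" "e \<noteq> 0"
  shows "herm e e \<noteq> 0"
proof
  assume "herm e e = 0"
  then obtain f where f: "herm f f = 0" "herm e f = 1" using e(2) by (rule isotropic_complement)
  obtain P Q where F: "frame J21 P Q" and P: "P *v axis 1 1 = e"
    using null_frame[OF \<open>herm e e = 0\<close> f] .
  have PQ: "P ** Q = mat 1" "Q ** P = mat 1" using F by (simp_all add: frame_def)
  define w where "w = (\<lambda>x. Q ** x ** P) ` v"
  note fi = frame_image[OF F v(1), folded w_def]
  have neg_w: "Re (trace (x ** x)) \<le> 0" if "x \<in> w" for x using neg that by (rule fi(7))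
  have X_w: "Q ** z ** P \<in> w" using z(1) unfolding w_def by auto
  obtain c b g s t where X: "Q ** z ** P = mk c b g s t"
    using subsetD[OF fi(1) X_w] by (rule su_form_J21E)
  have "mk c b g s t *v axis 1 1 = k *s axis 1 1"
    using frame_eigenvector[OF F P e(1)] unfolding X .
  then have gt: "g = 0" "t = 0" by (simp_all add: mk_def mat3_axis_eigenvector)
  have "det (mk c b g s t) = 0" unfolding X[symmetric] by (simp add: det_mul z(3))
  then have "c * (cnj c - c) * cnj c = 0" by (simp add: gt mk_def det_mat3)
  then have "c = 0 \<or> cnj c - c = 0" by auto
  then have "c = 0 \<or> Im c = 0" by (auto simp: complex_eq_iff)
  moreover have "Re (trace (mk c b g s t ** mk c b g s t)) \<le> 0" using neg_w[OF X_w] unfolding X .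
  then have "2 * (Re c)\<^sup>2 - 6 * (Im c)\<^sup>2 \<le> 0" by (simp add: trace_mk_square gt)
  ultimately have "c = 0" by (auto simp: complex_eq_iff)
  have "mk 0 b 0 s 0 \<noteq> 0"
  proof
    assume "mk 0 b 0 s 0 = 0"
    then have "P ** (Q ** z ** P) ** Q = P ** 0 ** Q" using X gt \<open>c = 0\<close> by simp
    then have "z = P ** 0 ** Q" unfolding conjugation_inverse[OF PQ(1)] .
    then show False using z(2) linear_0[OF linear_conjugation[of P Q]] by simp
  qed
  then have "lie_solvable w"
    using X_w unfolding X gt \<open>c = 0\<close> by (intro lie_solvable_if_upper_nilpotent[OF fi(1-3) neg_w])
  then have "lie_solvable ((\<lambda>x. P ** x ** Q) ` w)"
    by (rule lie_solvable_image[OF linear_conjugation conjugation_bracket[OF PQ(2)]])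
  moreover have "(\<lambda>x. P ** x ** Q) ` w = v"
    unfolding w_def image_image conjugation_inverse[OF PQ(1)] by simp
  ultimately show False using v(2) by simp
qed

text \<open>If the trace were zero, the cube of \<open>z\<close> would vanish. Whenever
  \<open>z\<close> maps \<open>z *v f\<close> to zero, skewness makes \<open>z *v f\<close>
  isotropic, so it must be zero; applied twice to an arbitrary vector, this gives
  \<open>z = 0\<close>.\<close>

lemma singular_trace_negative:
  assumes v: "lie_subalgebra v su21" "\<not> lie_solvable v"
    and neg: "\<And>x. x \<in> v \<Longrightarrow> Re (trace (x ** x)) \<le> 0"
    and z: "z \<in> v" "z \<noteq> 0" "det z = 0"
  shows "Re (trace (z ** z)) < 0"
proof (rule ccontr)
  assume "\<not> Re (trace (z ** z)) < 0"
  then have "Re (trace (z ** z)) = 0" using neg[OF z(1)] by simp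
  have zs: "z \<in> su21" using v(1) z(1) unfolding lie_subalgebra_def by auto
  have tr: "trace (z ** z) = 0"
    using trace_square_su21_real[OF zs] \<open>Re (trace (z ** z)) = 0\<close> by simp
  note z3 = cayley_hamilton3[OF trace_su21[OF zs] tr z(3)]
  have no_image: "z *v f = 0" if "z *v (z *v f) = 0" for f
  proof (rule ccontr)
    assume "z *v f \<noteq> 0"
    moreover have "herm (z *v f) (z *v f) = 0"
      unfolding herm_skew[OF zs, of f] that by (simp add: herm_def)
    moreover have "z *v (z *v f) = 0 *s (z *v f)" using that by simp
    ultimately show False using no_isotropic_eigenvector[OF v neg z, of "z *v f" 0] by blast
  qed
  have "z *v u = 0" for u
  proof -
    have "z *v (z *v (z *v u)) = 0"
      by (simp add: matrix_vector_mul_assoc matrix_mul_assoc[symmetric] z3)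
    then show ?thesis using no_image by blast
  qed
  then have "z = 0" by (simp add: matrix_eq)
  then show False using z(2) by contradiction
qed

lemma herm_self_real: "herm e e = complex_of_real (Re (herm e e))"
  using herm_commute[of e e] by (simp add: complex_eq_iff)

lemma normalize_positive:
  assumes "Re (herm e e) > 0"
  obtains c where "herm (c *s e) (c *s e) = 1"
proof -
  define c where "c = complex_of_real (1 / sqrt (Re (herm e e)))"
  have "herm (c *s e) (c *s e) = c * cnj c * herm e e"
    by (simp add: herm_scale_left herm_scale_right mult_ac)
  also have "c * cnj c = complex_of_real (1 / Re (herm e e))"
    using assms by (simp add: c_def of_real_mult[symmetric] del: of_real_mult of_real_divide)
  also have "\<dots> * herm e e = 1"
    by (subst (2) herm_self_real) (use assms in \<open>simp add: of_real_mult[symmetric] del: of_real_mult of_real_divide\<close>)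
  finally show ?thesis by (rule that)
qed

text \<open>The positive eigenvectors become the first two basis vectors. By the vanishing trace,
  the three choices of \<open>a\<close> and \<open>b\<close> leave the eigenvalue 0,
  \<open>- \<i>\<close> or \<open>\<i>\<close> for the negative direction.\<close>

lemma conjugate_v36_if_eigenvectors:
  assumes v: "lie_subalgebra v su21" "v \<noteq> {0}" "lie_semisimple v"
    and neg: "\<And>x. x \<in> v \<Longrightarrow> Re (trace (x ** x)) \<le> 0"
    and z: "z \<in> v" "z *v p = (\<i> * complex_of_real a) *s p" "z *v q = (\<i> * complex_of_real b) *s q"
    and pq: "Re (herm p p) > 0" "Re (herm q q) > 0" "herm p q = 0"
    and ab: "a = 1 \<and> b = - 1 \<or> a = 0 \<and> b = 1 \<or> a = 0 \<and> b = - 1"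
  shows "SU21_conjugate v v36"
proof -
  obtain c where c: "herm (c *s p) (c *s p) = 1" using pq(1) by (rule normalize_positive)
  obtain d where d: "herm (d *s q) (d *s q) = 1" using pq(2) by (rule normalize_positive)
  have o: "herm (c *s p) (d *s q) = 0" by (simp add: herm_scale_left herm_scale_right pq(3))
  obtain P Q where F: "frame N21 P Q" and P: "P *v axis 1 1 = c *s p" "P *v axis 2 1 = d *s q"
    using orthonormal_frame[OF c d o] .
  define w where "w = (\<lambda>x. Q ** x ** P) ` v"
  note fi = frame_image[OF F v(1), folded w_def]
  have neg_w: "Re (trace (x ** x)) \<le> 0" if "x \<in> w" for x using neg that by (rule fi(7))
  have X_w: "Q ** z ** P \<in> w" using z(1) unfolding w_def by auto
  obtain x y s t u where X: "Q ** z ** P = nk x y s t u"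
    using subsetD[OF fi(1) X_w] by (rule su_form_N21E)
  have "nk x y s t u *v axis 1 1 = (\<i> * complex_of_real a) *s axis 1 1"
    using frame_eigenvector[OF F P(1) eigenvector_scale[OF z(2)]] unfolding X .
  moreover have "nk x y s t u *v axis 2 1 = (\<i> * complex_of_real b) *s axis 2 1"
    using frame_eigenvector[OF F P(2) eigenvector_scale[OF z(3)]] unfolding X .
  ultimately have "x = a" "y = b" "s = 0" "t = 0" "u = 0"
    unfolding nk_def mat3_axis_eigenvector by simp_all
  then have ab_w: "nk a b 0 0 0 \<in> w" using X_w X by simp
  have reg: "nk 1 (- 1) 0 0 0 \<in> w \<or> nk 0 1 0 0 0 \<in> w"
    using ab ab_w subspace_neg[OF fi(2), of "nk 0 (- 1) 0 0 0"] nk_scaleR[of "- 1" 0 "- 1" 0 0 0] by auto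
  have u2: "\<exists>a b p. y = nk a b p 0 0" if "y \<in> w" for y
    by (rule in_u2_if_regular_elliptic[OF fi(1-3) neg_w reg that])
  have "w = span {nk 1 (- 1) 0 0 0, nk 0 0 1 0 0, nk 0 0 \<i> 0 0}"
    by (rule eq_su2[OF fi(4)[OF v(3)] fi(2) fi(5)[OF v(2)] fi(3) u2])
  then show ?thesis
    using SU21_conjugate_frames[OF F frame_v36(1), of v v36] frame_v36(2) unfolding w_def by simp
qed

lemma elliptic_case:
  assumes v: "lie_subalgebra v su21" "v \<noteq> {0}" "lie_semisimple v"
    and neg: "\<And>x. x \<in> v \<Longrightarrow> Re (trace (x ** x)) \<le> 0"
  shows "SU21_conjugate v v36"
proof -
  have sub: "subspace v" and v_cl: "\<And>x y. x \<in> v \<Longrightarrow> y \<in> v \<Longrightarrow> bracket x y \<in> v"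
    using v(1) by (simp_all add: lie_subalgebra_def)
  have ns: "\<not> lie_solvable v" using lie_semisimple_not_solvable[OF v(3) sub v_cl] v(2) by blast
  obtain z0 where z0: "z0 \<in> v" "z0 \<noteq> 0" "det z0 = 0" using singular_element_exists[OF v(1) ns] .
  define T where "T = Re (trace (z0 ** z0))"
  have "T < 0" unfolding T_def by (rule singular_trace_negative[OF v(1) ns neg z0])
  \<comment> \<open>Normalizes the trace of the square to -2, which makes the characteristic
    polynomial \<open>- k - k ^ 3\<close>.\<close>
  define \<tau> where "\<tau> = sqrt (2 / - T)"
  have tau: "\<tau> * \<tau> * T = - 2" "\<tau> \<noteq> 0" using \<open>T < 0\<close> by (simp_all add: \<tau>_def)
  define z where "z = \<tau> *\<^sub>R z0"
  have zv: "z \<in> v" unfolding z_def by (rule subspace_scale[OF sub z0(1)])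
  have zn: "z \<noteq> 0" using tau z0(2) by (simp add: z_def)
  have "det z = \<tau> ^ 3 * det z0"
    by (cases z0 rule: mat3E) (simp add: z_def mat3_scaleR det_mat3 power3_eq_cube algebra_simps)
  then have zd: "det z = 0" using z0(3) by simp
  have zs: "z \<in> su21" using v(1) zv unfolding lie_subalgebra_def by auto
  have "Re (trace (z ** z)) = - 2"
    using tau(1) by (simp add: z_def matrix_linear_simps trace_scaleR T_def)
  then have tr: "trace (z ** z) = - 2" using trace_square_su21_real[OF zs] by simp
  have cp: "det (z - mat k) = - k - k ^ 3" for k
    unfolding char_poly3[OF trace_su21[OF zs]] zd tr by simp
  have "det (z - mat 0) = 0" "det (z - mat \<i>) = 0" "det (z - mat (- \<i>)) = 0"
    unfolding cp by (simp_all add: power3_eq_cube)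
  then obtain e0 e1 e2 where e: "e0 \<noteq> 0" "z *v e0 = 0 *s e0" "e1 \<noteq> 0" "z *v e1 = \<i> *s e1"
    "e2 \<noteq> 0" "z *v e2 = (- \<i>) *s e2"
    by (metis eigenvector_exists)
  have nz: "herm u u \<noteq> 0" if "z *v u = k *s u" "u \<noteq> 0" for u k
    using neg zv zn zd that by (rule no_isotropic_eigenvector[OF v(1) ns])
  have real: "Re (herm e0 e0) \<noteq> 0" "Re (herm e1 e1) \<noteq> 0" "Re (herm e2 e2) \<noteq> 0"
    using nz[OF e(2,1)] nz[OF e(4,3)] nz[OF e(6,5)] herm_self_real[of e0] herm_self_real[of e1] herm_self_real[of e2]
    by auto
  have orth: "herm e0 e1 = 0" "herm e0 e2 = 0" "herm e1 e2 = 0"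
    by (rule eigenvectors_orthogonal[OF zs e(2,4)] eigenvectors_orthogonal[OF zs e(2,6)]
        eigenvectors_orthogonal[OF zs e(4,6)]; simp)+
  note conj36 = conjugate_v36_if_eigenvectors[OF v neg zv]
  show ?thesis
  \<comment> \<open>Of the three pairwise orthogonal eigenvectors at most one is negative, so two
    positive ones can always be chosen.\<close>
  proof (cases "Re (herm e0 e0) > 0")
    case True
    show ?thesis
    proof (cases "Re (herm e1 e1) > 0")
      case e1: True
      show ?thesis by (rule conj36[where p = e0 and a = 0 and q = e1 and b = 1]) (use e True e1 orth in simp_all)
    next
      case False
      then have "Re (herm e2 e2) > 0" using negative_not_orthogonal[of e1 e2] real orth(3) by force
      then show ?thesis by - (rule conj36[where p = e0 and a = 0 and q = e2 and b = "- 1"], use e True orth in simp_all)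
    qed
  next
    case False
    then have "Re (herm e0 e0) < 0" using real(1) by simp
    then have "Re (herm e1 e1) > 0" "Re (herm e2 e2) > 0"
      using negative_not_orthogonal[of e0 e1] negative_not_orthogonal[of e0 e2] real orth by force+
    then show ?thesis by - (rule conj36[where p = e1 and a = 1 and q = e2 and b = "- 1"], use e orth in simp_all)
  qed
qed

theorem theorem6p5:
  shows "(semisimple_proper_subalgebra v34 \<and>
          semisimple_proper_subalgebra v35 \<and>
          semisimple_proper_subalgebra v36) \<and>
         (\<forall>v. semisimple_proper_subalgebra v \<longrightarrow>
            SU21_conjugate v v34 \<or> SU21_conjugate v v35 \<or> SU21_conjugate v v36) \<and>
         (\<not> SU21_conjugate v34 v35 \<and>
          \<not> SU21_conjugate v34 v36 \<and>
          \<not> SU21_conjugate v35 v36)"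
proof (intro conjI allI impI)
  fix v assume "semisimple_proper_subalgebra v"
  then have v: "lie_subalgebra v su21" "v \<noteq> {0}" "v \<noteq> su21" "lie_semisimple v"
    by (simp_all add: semisimple_proper_subalgebra_def)
  show "SU21_conjugate v v34 \<or> SU21_conjugate v v35 \<or> SU21_conjugate v v36"
  proof (cases "\<exists>x\<in>v. Re (trace (x ** x)) > 0")
    case True
    then show ?thesis using hyperbolic_case[OF v(1,3,4)] by blast
  next
    case False
    then have "\<And>x. x \<in> v \<Longrightarrow> Re (trace (x ** x)) \<le> 0" by (simp add: not_less)
    then show ?thesis using elliptic_case[OF v(1,2,4)] by blast
  qed
qed (rule v34_semisimple v35_semisimple v36_semisimple not_conjugate_v34_v35 not_conjugate_standard)+

end
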